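(* The value functions of the original, convexified and relaxed problems coincide: $$v(x)=v_r(x)=\widetilde v(x)\quad\text{for all } x\ge 0.$$
   Context: Setting. $\mathbb R_+=[0,\infty)$. $A\subset\mathbb R_+$ is a closed set and $Q\subset\mathbb R_+$ is a compact set, with $0\in A\cap Q$, $A\setminus\{0\}\ne\emptyset$, $Q\setminus\{0\}\neq\emptyset$. The revenue $R:Q\to\mathbb R_+$ is continuous with $R(0)=0$. The production cost $C:A\to\mathbb R_+$ is continuous and non-decreasing; if $A$ is unbounded, then additionally $C(\alpha)/\alpha\to+\infty$ as $A\ni\alpha\to+\infty$. The constant $\beta>0$ is fixed. Original problem. For $x\ge 0$, $\mathscr A(x)$ is the set of pairs of Borel measurable functions $\alpha:\mathbb R_+\to A$, $q:\mathbb R_+\to Q$ (with $\alpha$ locally integrable) such that $X_t=x+\int_0^t(\alpha_s-q_s)\,ds\ge 0$ for all $t\ge 0$, and $$v(x)=\sup_{(\alpha,q)\in\mathscr A(x)}\int_0^\infty e^{-\beta t}(R(q_t)-C(\alpha_t))\,dt.$$ Convexified problem. For $G\subset\mathbb R$, $\mathrm{co}\,G$ is the intersection of all intervals containing $G$. Put $C=+\infty$ off $A$ and $R=-\infty$ off $Q$. For $f:\mathbb R\to(-\infty,+\infty]$ with $\mathrm{dom} f=\{f<\infty\}$, $$(\mathrm{co} f)(x)=\inf\{\delta f(x_1)+(1-\delta)f(x_2):\delta\in[0,1],\ x_i\in\mathrm{dom} f,\ \delta x_1+(1-\delta)x_2=x\}.$$ Let $\widetilde C=\mathrm{co}\,C$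 and $\widetilde R=-\mathrm{co}(-R)$ (finite exactly on $\mathrm{co}\,A$ and $\mathrm{co}\,Q$ respectively; they coincide with the Young-Fenchel biconjugates $C^{**}$ and $-(-R)^{**}$). Let $\widetilde{\mathscr A}(x)$ be the set of pairs of Borel measurable functions $\alpha:\mathbb R_+\to\mathrm{co}\,A$, $q:\mathbb R_+\to\mathrm{co}\,Q$ ($\alpha$ locally integrable) with $x+\int_0^t(\alpha_s-q_s)\,ds\ge0$ for all $t\ge0$, and $$\widetilde v(x)=\sup_{(\alpha,q)\in\widetilde{\mathscr A}(x)}\int_0^\infty e^{-\beta t}(\widetilde R(q_t)-\widetilde C(\alpha_t))\,dt.$$ Relaxed problem. Relaxed controls $q_t(dy)$, $\alpha_t(dy)$ are mappings from $[0,\infty)$ to the sets of probability measures on $Q$ and $A$ respectively such that $t\mapsto\int_Q\varphi(y)\,q_t(dy)$ and $t\mapsto\int_A\varphi(y)\,\alpha_t(dy)$ are Borel measurable for every bounded continuous function $\varphi$. The class $\mathscr A_r(x)$ consists of those relaxed controls (with $t\mapsto\int_A y\,\alpha_t(dy)$ locally integrable) for which $$X_t=x+\int_0^t\int_A y\,\alpha_s(dy)\,ds-\int_0^t\int_Q y\,q_s(dy)\,ds\ge0\quad\text{for all }t\ge0,$$ and $$v_r(x)=\sup_{(\alpha,q)\in\mathscr A_r(x)}\left(\int_0^\infty e^{-\beta t}\int_Q R(y)\,q_t(dy)\,dt-\int_0^\infty e^{-\beta t}\int_A C(y)\,\alpha_t(dy)\,dt\right).$$ All objective functionals take values in $[-\infty,\infty)$.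 *)

theory Defs
  imports "HOL-Probability.Probability"
begin

text \<open>
  Integral over \<open>[0,\<infinity>)\<close> with values in \<^typ>\<open>ereal\<close>: positive part minus negative part. The
  Bochner integral is unsuitable for the objectives, since it returns 0 when the discounted
  production cost is not integrable, where the objective must be \<open>-\<infinity>\<close>. For revenues bounded on
  \<open>Q\<close> (continuous on a compact set) and nonnegative costs the positive part is finite, so \<open>\<infinity> - \<infinity>\<close> does not arise.
\<close>
definition ext_integral :: "(real \<Rightarrow> ereal) \<Rightarrow> ereal" where
  "ext_integral f =
     enn2ereal (\<integral>\<^sup>+ t\<in>{0..}. e2ennreal (f t) \<partial>lborel)
     - enn2ereal (\<integral>\<^sup>+ t\<in>{0..}. e2ennreal (- f t) \<partial>lborel)"

definition locally_integrable :: "(real \<Rightarrow> real) \<Rightarrow> bool" where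
  "locally_integrable f \<longleftrightarrow> (\<forall>T\<ge>0. set_integrable lborel {0..T} f)"

text \<open>
  Pairs of Borel controls \<open>[0,\<infinity>) \<rightarrow> A\<close> and \<open>[0,\<infinity>) \<rightarrow> Q\<close>; membership of the values in
  \<open>A\<close> and \<open>Q\<close> is part of measurability into the restricted spaces. Values at negative times
  are irrelevant.
\<close>
definition admissible ::
    "real set \<Rightarrow> real set \<Rightarrow> real \<Rightarrow> ((real \<Rightarrow> real) \<times> (real \<Rightarrow> real)) set" where
  "admissible A Q x = {(\<alpha>, q).
     \<alpha> \<in> restrict_space borel {0..} \<rightarrow>\<^sub>M restrict_space borel A \<and>
     q \<in> restrict_space borel {0..} \<rightarrow>\<^sub>M restrict_space borel Q \<and>
     locally_integrable \<alpha> \<and>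
     (\<forall>t\<ge>0. x + (LBINT s:{0..t}. \<alpha> s - q s) \<ge> 0)}"

definition value_orig ::
    "real set \<Rightarrow> real set \<Rightarrow> (real \<Rightarrow> real) \<Rightarrow> (real \<Rightarrow> real) \<Rightarrow> real \<Rightarrow> real \<Rightarrow> ereal" where
  "value_orig A Q R C \<beta> x =
     (SUP (\<alpha>, q) \<in> admissible A Q x.
        ext_integral (\<lambda>t. ereal (exp (- \<beta> * t) * (R (q t) - C (\<alpha> t)))))"

definition co_set :: "real set \<Rightarrow> real set" where
  "co_set G = is_interval hull G"

definition co_fun :: "(real \<Rightarrow> ereal) \<Rightarrow> real \<Rightarrow> ereal" where
  "co_fun f x = Inf {ereal \<delta> * f x1 + ereal (1 - \<delta>) * f x2 | \<delta> x1 x2.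
     \<delta> \<in> {0..1} \<and> f x1 < \<infinity> \<and> f x2 < \<infinity> \<and> \<delta> * x1 + (1 - \<delta>) * x2 = x}"

definition C_tilde :: "real set \<Rightarrow> (real \<Rightarrow> real) \<Rightarrow> real \<Rightarrow> ereal" where
  "C_tilde A C = co_fun (\<lambda>y. if y \<in> A then ereal (C y) else \<infinity>)"

definition R_tilde :: "real set \<Rightarrow> (real \<Rightarrow> real) \<Rightarrow> real \<Rightarrow> ereal" where
  "R_tilde Q R = (\<lambda>x. - co_fun (\<lambda>y. - (if y \<in> Q then ereal (R y) else -\<infinity>)) x)"

definition value_conv ::
    "real set \<Rightarrow> real set \<Rightarrow> (real \<Rightarrow> real) \<Rightarrow> (real \<Rightarrow> real) \<Rightarrow> real \<Rightarrow> real \<Rightarrow> ereal" where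
  "value_conv A Q R C \<beta> x =
     (SUP (\<alpha>, q) \<in> admissible (co_set A) (co_set Q) x.
        ext_integral (\<lambda>t. ereal (exp (- \<beta> * t)) * (R_tilde Q R (q t) - C_tilde A C (\<alpha> t))))"

definition relaxed_control :: "real set \<Rightarrow> (real \<Rightarrow> real measure) \<Rightarrow> bool" where
  "relaxed_control S \<mu> \<longleftrightarrow>
     (\<forall>t\<ge>0. \<mu> t \<in> space (prob_algebra (restrict_space borel S))) \<and>
     (\<forall>\<phi> :: real \<Rightarrow> real. continuous_on S \<phi> \<and> bounded (\<phi> ` S) \<longrightarrow>
        (\<lambda>t. \<integral>y. \<phi> y \<partial>\<mu> t) \<in> borel_measurable (restrict_space borel {0..}))"

text \<open>
  The Bochner integral of the identity is 0 for a measure on \<open>A\<close> with infinite mean. Local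
  integrability of the \<open>[0,\<infinity>]\<close>-valued map \<open>t \<mapsto> \<integral> y \<alpha>\<^sub>t(dy)\<close> therefore includes the
  requirement that the mean is finite for almost every \<open>t\<close>.
\<close>
definition relaxed_admissible ::
    "real set \<Rightarrow> real set \<Rightarrow> real \<Rightarrow> ((real \<Rightarrow> real measure) \<times> (real \<Rightarrow> real measure)) set" where
  "relaxed_admissible A Q x = {(\<alpha>, q).
     relaxed_control A \<alpha> \<and> relaxed_control Q q \<and>
     (AE t in lborel. 0 \<le> t \<longrightarrow> integrable (\<alpha> t) (\<lambda>y. y)) \<and>
     locally_integrable (\<lambda>t. \<integral>y. y \<partial>\<alpha> t) \<and>
     (\<forall>t\<ge>0. x + (LBINT s:{0..t}. (\<integral>y. y \<partial>\<alpha> s)) - (LBINT s:{0..t}. (\<integral>y. y \<partial>q s)) \<ge> 0)}"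

text \<open>
  \<open>R\<close> and \<open>C\<close> are assumed nonnegative on \<open>Q\<close> and \<open>A\<close>, so nonnegative integrals apply; the inner
  integral of \<open>C\<close> may be infinite.
\<close>
definition value_relaxed ::
    "real set \<Rightarrow> real set \<Rightarrow> (real \<Rightarrow> real) \<Rightarrow> (real \<Rightarrow> real) \<Rightarrow> real \<Rightarrow> real \<Rightarrow> ereal" where
  "value_relaxed A Q R C \<beta> x =
     (SUP (\<alpha>, q) \<in> relaxed_admissible A Q x.
        enn2ereal (\<integral>\<^sup>+ t\<in>{0..}. (ennreal (exp (- \<beta> * t)) * (\<integral>\<^sup>+ y. ennreal (R y) \<partial>q t)) \<partial>lborel)
        - enn2ereal (\<integral>\<^sup>+ t\<in>{0..}. (ennreal (exp (- \<beta> * t)) * (\<integral>\<^sup>+ y. ennreal (C y) \<partial>\<alpha> t)) \<partial>lborel))"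

end

theory Submission
  imports Defs
begin

text \<open>
  The chain \<open>v \<le> v\<^sub>r \<le> \<widetilde>v \<le> v\<close> is proved, where \<open>v\<close>, \<open>v\<^sub>r\<close>, \<open>\<widetilde>v\<close> are the original, the relaxed
  and the convexified value.

  The first inequality embeds an ordinary control as a family of Dirac measures. The second one
  replaces the measures \<open>\<alpha>\<^sub>t\<close>, \<open>q\<^sub>t\<close> by their means, which leaves the state unchanged; by Jensen's
  inequality for the envelopes this can only lower the cost and raise the revenue. Jensen's
  inequality rests on a supporting line at an interior point of \<open>co A\<close>. It is read off from the
  definition of the envelope by comparing the slopes of chords that pass over that point
  (\<open>supporting_line\<close>, \<open>envelope_Jensen\<close>).

  The third inequality is a chattering argument. Cut time into cells of length \<open>h\<close>. On each cell
  the convexified controls are averaged, which by Jensen costs nothing apart from the variation of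
  the discount factor, and that is a factor between \<open>1\<close> and \<open>e\<^bsup>\<beta>h\<^esup>\<close>. Each average is a mixture of
  two admissible levels whose mixed cost (or revenue) is within \<open>h\<close> of the envelope, and the new
  control uses each of the two levels for the corresponding fraction of the cell. The order of the
  levels settles the state constraint: production runs at the higher level first, sales at the lower
  level first. The net rate is then nonincreasing on the cell, so the new state, which agrees with
  the old one at the grid points, never falls below the smaller of its two end values there
  (\<open>nonneg_of_nonneg_at_grid\<close>). With discounted revenue \<open>P\<close> and cost \<open>N\<close> of the given control,
  \<open>v\<close> is at least \<open>e\<^bsup>-\<beta>h\<^esup> P - h/\<beta> - e\<^bsup>\<beta>h\<^esup> (N + h/\<beta>)\<close>, and \<open>h \<rightarrow> 0\<close> gives \<open>P - N\<close>. A control with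
  \<open>N = \<infinity>\<close> has objective \<open>-\<infinity>\<close>.
\<close>

section \<open>Convex envelopes on the line and Jensen's inequality\<close>

lemma is_interval_co_set: "is_interval (co_set S)"
  unfolding co_set_def
  by (rule is_interval_convex_1[THEN iffD2])
    (auto simp: hull_def is_interval_convex_1 intro!: convex_Inter)

lemma co_set_iff: "y \<in> co_set S \<longleftrightarrow> (\<exists>a\<in>S. \<exists>b\<in>S. a \<le> y \<and> y \<le> b)"
proof
  let ?H = "{y. \<exists>a\<in>S. \<exists>b\<in>S. a \<le> y \<and> y \<le> b}"
  have "is_interval ?H"
    unfolding is_interval_1 by (blast intro: order_trans)
  moreover have "S \<subseteq> ?H" by blast
  ultimately have "co_set S \<subseteq> ?H"
    unfolding co_set_def by (intro hull_minimal)
  then show "y \<in> co_set S \<Longrightarrow> \<exists>a\<in>S. \<exists>b\<in>S. a \<le> y \<and> y \<le> b" by blast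
next
  assume "\<exists>a\<in>S. \<exists>b\<in>S. a \<le> y \<and> y \<le> b"
  then obtain a b where ab: "a \<in> S" "b \<in> S" "a \<le> y" "y \<le> b" by blast
  moreover have "S \<subseteq> co_set S" unfolding co_set_def by (rule hull_subset)
  ultimately show "y \<in> co_set S"
    using mem_is_interval_1_I[OF is_interval_co_set] by blast
qed

lemma subset_co_set: "S \<subseteq> co_set S"
  by (auto simp: co_set_iff)

lemma is_interval_imp_borel:
  fixes S :: "real set"
  assumes "is_interval S"
  shows "S \<in> sets borel"
  using is_real_interval[OF assms] by auto

text \<open>
  The values at \<open>x\<close> of all chords of the graph of \<open>f\<close> over \<open>S\<close>.
  Working with a real function on an explicit domain keeps the analysis of the envelope free of
  \<open>\<plusminus>\<infinity>\<close>; on \<open>co_set S\<close>, where the set below is nonempty,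
  the infimum is finite as soon as \<open>f\<close> is bounded below.
\<close>
definition chord_values :: "real set \<Rightarrow> (real \<Rightarrow> real) \<Rightarrow> real \<Rightarrow> real set" where
  "chord_values S f x = {\<delta> * f x1 + (1 - \<delta>) * f x2 | \<delta> x1 x2.
     \<delta> \<in> {0..1} \<and> x1 \<in> S \<and> x2 \<in> S \<and> \<delta> * x1 + (1 - \<delta>) * x2 = x}"

definition envelope :: "real set \<Rightarrow> (real \<Rightarrow> real) \<Rightarrow> real \<Rightarrow> real" where
  "envelope S f x = Inf (chord_values S f x)"

lemma chord_valuesI:
  assumes "a \<in> S" "b \<in> S" "0 \<le> \<delta>" "\<delta> \<le> 1" "\<delta> * a + (1 - \<delta>) * b = x"
  shows "\<delta> * f a + (1 - \<delta>) * f b \<in> chord_values S f x"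
  unfolding chord_values_def using assms by auto

lemma between_chord:
  fixes a b y :: real
  assumes "a < b" "a \<le> y" "y \<le> b"
  shows "0 \<le> (b - y) / (b - a)" "(b - y) / (b - a) \<le> 1"
    "(b - y) / (b - a) * a + (1 - (b - y) / (b - a)) * b = y"
proof -
  show "0 \<le> (b - y) / (b - a)" "(b - y) / (b - a) \<le> 1"
    using assms by (auto simp: divide_simps)
  have "d * a + (1 - d) * b = b - d * (b - a)" for d
    by (simp add: algebra_simps)
  then have "(b - y) / (b - a) * a + (1 - (b - y) / (b - a)) * b = b - (b - y) / (b - a) * (b - a)" .
  also have "\<dots> = y" using assms by simp
  finally show "(b - y) / (b - a) * a + (1 - (b - y) / (b - a)) * b = y" .
qed

lemma chord_values_nonempty:
  assumes "y \<in> co_set S"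
  shows "chord_values S f y \<noteq> {}"
proof -
  obtain a b where ab: "a \<in> S" "b \<in> S" "a \<le> y" "y \<le> b" using assms co_set_iff by blast
  show ?thesis
  proof (cases "a = b")
    case True
    then have "1 * f a + (1 - 1) * f a \<in> chord_values S f y"
      by (intro chord_valuesI) (use ab in auto)
    then show ?thesis by blast
  next
    case False
    then have "a < b" using ab by simp
    from chord_valuesI[OF ab(1,2) between_chord[OF this ab(3,4)]] show ?thesis by blast
  qed
qed

lemma affine_le_chord_values:
  assumes "\<And>y. y \<in> S \<Longrightarrow> B + k * y \<le> f y" "v \<in> chord_values S f x"
  shows "B + k * x \<le> v"
proof -
  obtain \<delta> a b where d: "v = \<delta> * f a + (1 - \<delta>) * f b" "0 \<le> \<delta>" "\<delta> \<le> 1" "a \<in> S" "b \<in> S"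
    "\<delta> * a + (1 - \<delta>) * b = x"
    using assms(2) unfolding chord_values_def by auto
  have "B + k * x = \<delta> * (B + k * a) + (1 - \<delta>) * (B + k * b)"
    unfolding d(6)[symmetric] by (simp add: algebra_simps)
  also have "\<dots> \<le> v"
    unfolding d(1) by (intro add_mono mult_left_mono assms(1) d) (use d in auto)
  finally show ?thesis .
qed

lemma bdd_below_chord_values:
  assumes "bdd_below (f ` S)"
  shows "bdd_below (chord_values S f x)"
proof -
  obtain B where "\<And>y. y \<in> S \<Longrightarrow> B \<le> f y" using assms by (auto simp: bdd_below_def)
  then show ?thesis
    using affine_le_chord_values[of S B 0 f _ x] by (auto simp: bdd_below_def)
qed

lemma envelope_le_chord:
  assumes "bdd_below (f ` S)" "v \<in> chord_values S f x"
  shows "envelope S f x \<le> v"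
  unfolding envelope_def by (rule cInf_lower[OF assms(2) bdd_below_chord_values[OF assms(1)]])

lemma envelope_le:
  assumes "bdd_below (f ` S)" "y \<in> S"
  shows "envelope S f y \<le> f y"
  using envelope_le_chord[OF assms(1) chord_valuesI[OF assms(2,2), of 1]] by simp

text \<open>
  Chords of an affine function lie on its graph, so an affine minorant on \<open>S\<close> lies below
  every chord. This transports bounds and supporting lines from \<open>f\<close> to its envelope.
\<close>
lemma affine_le_envelope:
  assumes "\<And>y. y \<in> S \<Longrightarrow> B + k * y \<le> f y" "x \<in> co_set S"
  shows "B + k * x \<le> envelope S f x"
  unfolding envelope_def
  by (rule cInf_greatest[OF chord_values_nonempty[OF assms(2)] affine_le_chord_values[OF assms(1)]])

text \<open>
  The endpoints are returned in increasing order because a switching control needs to know which of its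
  two levels is the higher one.
\<close>
lemma near_optimal_chord:
  assumes "x \<in> co_set S" "0 < \<epsilon>"
  shows "\<exists>\<delta> a b. a \<in> S \<and> b \<in> S \<and> a \<le> b \<and> 0 \<le> \<delta> \<and> \<delta> \<le> 1 \<and> \<delta> * a + (1 - \<delta>) * b = x
    \<and> \<delta> * f a + (1 - \<delta>) * f b \<le> envelope S f x + \<epsilon>"
proof -
  have "Inf (chord_values S f x) < envelope S f x + \<epsilon>"
    using assms(2) by (simp add: envelope_def)
  then obtain v where v: "v \<in> chord_values S f x" "v < envelope S f x + \<epsilon>"
    using cInf_lessD[OF chord_values_nonempty[OF assms(1)]] by blast
  then obtain \<delta> a b where d: "v = \<delta> * f a + (1 - \<delta>) * f b" "0 \<le> \<delta>" "\<delta> \<le> 1" "a \<in> S" "b \<in> S"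
    "\<delta> * a + (1 - \<delta>) * b = x"
    unfolding chord_values_def by auto
  show ?thesis
  proof (cases "a \<le> b")
    case True
    then show ?thesis using d v by fastforce
  next
    case False
    then show ?thesis using d v
      by (intro exI[of _ "1 - \<delta>"] exI[of _ b] exI[of _ a]) (auto simp: algebra_simps)
  qed
qed

text \<open>
  A chord from a point left of \<open>m\<close> to a point right of \<open>m\<close> lies on or above the
  envelope at \<open>m\<close>. Hence every slope from the left into the point \<open>(m, envelope S f
  m)\<close> is at most every slope out of it to the right, and any number in between is the slope of an
  affine minorant of \<open>f\<close> through that point, which is then a minorant of the envelope as
  well.
\<close>
lemma supporting_line:
  assumes bd: "bdd_below (f ` S)" and a: "a0 \<in> S" "a0 < m" and b: "b0 \<in> S" "m < b0"
  shows "\<exists>k. \<forall>y\<in>co_set S. envelope S f m + k * (y - m) \<le> envelope S f y"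
proof -
  let ?e = "envelope S f m"
  let ?L = "(\<lambda>a. (?e - f a) / (m - a)) ` {a\<in>S. a < m}"
  have slopes: "(?e - f a) / (m - a) \<le> (f b - ?e) / (b - m)"
    if "a \<in> S" "a < m" "b \<in> S" "m < b" for a b
  proof -
    let ?d = "(b - m) / (b - a)"
    have ab: "a < b" "a \<le> m" "m \<le> b" using that by auto
    have "?e \<le> ?d * f a + (1 - ?d) * f b"
      by (rule envelope_le_chord[OF bd chord_valuesI[OF that(1,3) between_chord[OF ab]]])
    then have "?e * (b - a) \<le> (?d * f a + (1 - ?d) * f b) * (b - a)"
      using ab by (intro mult_right_mono) auto
    also have "\<dots> = (?d * (b - a)) * f a + ((b - a) - ?d * (b - a)) * f b"
      by (simp only: ring_distribs mult_1 mult_ac)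
    also have "\<dots> = (b - m) * f a + (m - a) * f b"
      using ab by simp
    finally have "(?e - f a) * (b - m) \<le> (f b - ?e) * (m - a)"
      by (simp add: algebra_simps)
    then show ?thesis using that by (simp add: divide_simps)
  qed
  have bdd: "bdd_above ?L" using slopes[OF _ _ b] by (auto simp: bdd_above_def)
  define k where "k = Sup ?L"
  have "?e - k * m + k * y \<le> f y" if y: "y \<in> S" for y
  proof -
    consider "y < m" | "y = m" | "m < y" by linarith
    then show ?thesis
    proof cases
      case 1
      then have "(?e - f y) / (m - y) \<le> k"
        unfolding k_def using y by (intro cSup_upper bdd) auto
      then have "?e - f y \<le> k * (m - y)" using 1 by (simp add: divide_simps)
      then show ?thesis by (simp add: algebra_simps)
    next
      case 2
      then show ?thesis using envelope_le[OF bd y] by simp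
    next
      case 3
      have "k \<le> (f y - ?e) / (y - m)"
        unfolding k_def using a slopes[OF _ _ y 3] by (intro cSup_least) auto
      then have "k * (y - m) \<le> f y - ?e" using 3 by (simp add: divide_simps)
      then show ?thesis by (simp add: algebra_simps)
    qed
  qed
  then have "\<forall>y\<in>co_set S. ?e - k * m + k * y \<le> envelope S f y"
    by (blast intro: affine_le_envelope)
  then show ?thesis by (intro exI[of _ k]) (simp add: algebra_simps)
qed

text \<open>
  Sublevel sets are intervals: at a point strictly between two others the supporting line rises towards
  at least one of them.
\<close>
lemma envelope_borel_measurable:
  assumes bd: "bdd_below (f ` S)"
  shows "envelope S f \<in> borel_measurable (restrict_space borel (co_set S))"
proof (rule borel_measurableI_le)
  fix c
  have "is_interval {y \<in> co_set S. envelope S f y \<le> c}"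
    unfolding is_interval_1
  proof (intro ballI allI impI)
    fix x z y assume xz: "x \<in> {y \<in> co_set S. envelope S f y \<le> c}" "z \<in> {y \<in> co_set S. envelope S f y \<le> c}"
      and y: "x \<le> y \<and> y \<le> z"
    have "y \<in> co_set S"
      using is_interval_co_set[of S] xz y unfolding is_interval_1 by blast
    moreover have "envelope S f y \<le> c"
    proof (cases "x = y \<or> y = z")
      case True then show ?thesis using xz by auto
    next
      case False
      then have less: "x < y" "y < z" using y by auto
      obtain a0 b0 where "a0 \<in> S" "a0 \<le> x" "b0 \<in> S" "z \<le> b0"
        using xz by (auto simp: co_set_iff)
      then obtain k where k: "\<forall>w\<in>co_set S. envelope S f y + k * (w - y) \<le> envelope S f w"
        using supporting_line[OF bd, of a0 y b0] less by auto
      show ?thesis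
      proof (cases "k \<ge> 0")
        case True
        then have "0 \<le> k * (z - y)" using less by simp
        then show ?thesis using k xz by fastforce
      next
        case False
        then have "0 \<le> k * (x - y)" using less by (simp add: mult_nonpos_nonpos)
        then show ?thesis using k xz by fastforce
      qed
    qed
    ultimately show "y \<in> {y \<in> co_set S. envelope S f y \<le> c}" by simp
  qed
  then have "{y \<in> co_set S. envelope S f y \<le> c} \<in> sets borel" by (rule is_interval_imp_borel)
  moreover have "co_set S \<in> sets borel" by (intro is_interval_imp_borel is_interval_co_set)
  moreover have "{x \<in> space (restrict_space borel (co_set S)). envelope S f x \<le> c}
      = {y \<in> co_set S. envelope S f y \<le> c}"
    by (simp only: space_restrict_space space_borel Int_UNIV_right)
  ultimately show "{x \<in> space (restrict_space borel (co_set S)). envelope S f x \<le> c}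
      \<in> sets (restrict_space borel (co_set S))"
    by (subst sets_restrict_space_iff) auto
qed

text \<open>
  An interval contains every number that lies between two of its elements, and a mean cannot lie strictly
  on one side of all values.
\<close>
lemma mean_in_interval:
  fixes X :: "'a \<Rightarrow> real"
  assumes "finite_measure M" and pos: "0 < measure M (space M)" and X: "integrable M X"
    and XI: "\<And>w. w \<in> space M \<Longrightarrow> X w \<in> I" and I: "is_interval I"
  shows "(\<integral>w. X w \<partial>M) / measure M (space M) \<in> I"
proof -
  interpret finite_measure M by fact
  define m where "m = (\<integral>w. X w \<partial>M) / measure M (space M)"
  have eq: "(\<integral>w. m \<partial>M) = (\<integral>w. X w \<partial>M)" using pos by (simp add: m_def)
  have ne: "emeasure M (space M) \<noteq> 0" using pos by (simp add: emeasure_eq_measure)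
  have "\<exists>b\<in>I. m \<le> b"
  proof (rule ccontr)
    assume "\<not> ?thesis"
    then have "AE w in M. X w < m" using XI by (intro AE_I2) force
    then have "(\<integral>w. X w \<partial>M) < (\<integral>w. m \<partial>M)"
      by (intro integral_less_AE_space X ne) auto
    then show False using eq by simp
  qed
  moreover have "\<exists>a\<in>I. a \<le> m"
  proof (rule ccontr)
    assume "\<not> ?thesis"
    then have "AE w in M. m < X w" using XI by (intro AE_I2) force
    then have "(\<integral>w. m \<partial>M) < (\<integral>w. X w \<partial>M)"
      by (intro integral_less_AE_space X ne) auto
    then show False using eq by simp
  qed
  ultimately show ?thesis using I unfolding is_interval_1 m_def by blast
qed

text \<open>
  Integrate the supporting line at the mean \<open>m\<close>. If \<open>m\<close> is an end point of
  \<open>co_set S\<close>, there may be no supporting line, but then \<open>X = m\<close> almost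
  everywhere. The measure is not normalised, and \<open>F\<close> is any integrable majorant of the
  envelope along \<open>X\<close>: with \<open>F = f\<close> this serves the barycentre of a control
  measure, with \<open>F\<close> the envelope itself the time average of a control over a cell.
\<close>
lemma envelope_Jensen:
  fixes X F :: "'a \<Rightarrow> real"
  assumes fin: "finite_measure M" and pos: "0 < measure M (space M)" and X: "integrable M X"
    and XI: "\<And>w. w \<in> space M \<Longrightarrow> X w \<in> co_set S" and bd: "bdd_below (f ` S)"
    and F: "integrable M F" and le: "\<And>w. w \<in> space M \<Longrightarrow> envelope S f (X w) \<le> F w"
  shows "measure M (space M) * envelope S f ((\<integral>w. X w \<partial>M) / measure M (space M)) \<le> (\<integral>w. F w \<partial>M)"
proof -
  interpret finite_measure M by fact
  define m where "m = (\<integral>w. X w \<partial>M) / measure M (space M)"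
  have eq: "(\<integral>w. X w \<partial>M) = measure M (space M) * m" using pos by (simp add: m_def)
  have "m \<in> co_set S"
    unfolding m_def by (rule mean_in_interval[OF fin pos X XI is_interval_co_set])
  have "\<exists>k. AE w in M. envelope S f m + k * (X w - m) \<le> F w"
  proof (cases "(\<exists>a\<in>S. a < m) \<and> (\<exists>b\<in>S. m < b)")
    case True
    then obtain k where "\<forall>y\<in>co_set S. envelope S f m + k * (y - m) \<le> envelope S f y"
      using supporting_line[OF bd] by blast
    then show ?thesis
      by (intro exI[of _ k] AE_I2) (use XI le in force)
  next
    case False
    have "AE w in M. X w = m"
    proof (cases "\<exists>b\<in>S. m < b")
      case True
      then have "\<And>a. a \<in> S \<Longrightarrow> m \<le> a" using False by force
      then have "m \<le> y" if "y \<in> co_set S" for y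
        using that unfolding co_set_iff by (blast intro: order_trans)
      then have "AE w in M. 0 \<le> X w - m"
        using XI by (intro AE_I2) simp
      moreover have "(\<integral>w. X w - m \<partial>M) = 0" using X eq by simp
      ultimately have "AE w in M. X w - m = 0"
        using integral_nonneg_eq_0_iff_AE[of M "\<lambda>w. X w - m"] X by simp
      then show ?thesis by simp
    next
      case False
      then have "\<And>a. a \<in> S \<Longrightarrow> a \<le> m" by force
      then have "y \<le> m" if "y \<in> co_set S" for y
        using that unfolding co_set_iff by (blast intro: order_trans)
      then have "AE w in M. 0 \<le> m - X w"
        using XI by (intro AE_I2) simp
      moreover have "(\<integral>w. m - X w \<partial>M) = 0" using X eq by simp
      ultimately have "AE w in M. m - X w = 0"
        using integral_nonneg_eq_0_iff_AE[of M "\<lambda>w. m - X w"] X by simp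
      then show ?thesis by (rule AE_mp) simp
    qed
    moreover have "AE w in M. envelope S f (X w) \<le> F w" using le by (rule AE_I2)
    ultimately have "AE w in M. envelope S f m + 0 * (X w - m) \<le> F w"
      by eventually_elim simp
    then show ?thesis by blast
  qed
  then obtain k where k: "AE w in M. envelope S f m + k * (X w - m) \<le> F w" by blast
  have "(\<integral>w. envelope S f m + k * (X w - m) \<partial>M) \<le> (\<integral>w. F w \<partial>M)"
    by (rule integral_mono_AE[OF _ F k]) (use X in auto)
  moreover have "(\<integral>w. envelope S f m + k * (X w - m) \<partial>M) = measure M (space M) * envelope S f m"
    using X eq by (simp add: algebra_simps)
  ultimately show ?thesis unfolding m_def by simp
qed

lemma co_fun_eq_envelope:
  assumes bd: "bdd_below (f ` S)" and y: "y \<in> co_set S"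
    and g: "\<And>y. y \<in> S \<Longrightarrow> g y = ereal (f y)" "\<And>y. y \<notin> S \<Longrightarrow> g y = \<infinity>"
  shows "co_fun g y = ereal (envelope S f y)"
proof -
  have fin: "g z < \<infinity> \<longleftrightarrow> z \<in> S" for z using g[of z] by (cases "z \<in> S") auto
  have val: "ereal \<delta> * g x1 + ereal (1 - \<delta>) * g x2 = ereal (\<delta> * f x1 + (1 - \<delta>) * f x2)"
    if "x1 \<in> S" "x2 \<in> S" for \<delta> x1 x2
    by (simp only: g(1)[OF that(1)] g(1)[OF that(2)] times_ereal.simps plus_ereal.simps)
  have "{ereal \<delta> * g x1 + ereal (1 - \<delta>) * g x2 | \<delta> x1 x2.
     \<delta> \<in> {0..1} \<and> g x1 < \<infinity> \<and> g x2 < \<infinity> \<and> \<delta> * x1 + (1 - \<delta>) * x2 = y}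
    = {ereal (\<delta> * f x1 + (1 - \<delta>) * f x2) | \<delta> x1 x2.
     \<delta> \<in> {0..1} \<and> x1 \<in> S \<and> x2 \<in> S \<and> \<delta> * x1 + (1 - \<delta>) * x2 = y}"
    unfolding fin using val by (intro Collect_cong) metis
  also have "\<dots> = ereal ` chord_values S f y"
    unfolding chord_values_def by blast
  finally have sets_eq: "{ereal \<delta> * g x1 + ereal (1 - \<delta>) * g x2 | \<delta> x1 x2.
     \<delta> \<in> {0..1} \<and> g x1 < \<infinity> \<and> g x2 < \<infinity> \<and> \<delta> * x1 + (1 - \<delta>) * x2 = y} = ereal ` chord_values S f y" .
  have "co_fun g y = (INF v\<in>chord_values S f y. ereal v)"
    unfolding co_fun_def by (simp only: sets_eq)
  also have "\<dots> = ereal (Inf (chord_values S f y))"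
  proof (rule ereal_Inf[symmetric])
    obtain v where v: "v \<in> chord_values S f y" using chord_values_nonempty[OF y] by blast
    obtain B where "\<And>v. v \<in> chord_values S f y \<Longrightarrow> B \<le> v"
      using bdd_below_chord_values[OF bd, of y] unfolding bdd_below_def by blast
    then have "ereal B \<le> (INF v\<in>chord_values S f y. ereal v)" by (intro INF_greatest) simp
    moreover have "(INF v\<in>chord_values S f y. ereal v) \<le> ereal v" by (rule INF_lower[OF v])
    ultimately show "\<bar>INF v\<in>chord_values S f y. ereal v\<bar> \<noteq> \<infinity>" by auto
  qed
  finally show ?thesis by (simp add: envelope_def)
qed

lemma C_tilde_eq_envelope:
  assumes "bdd_below (C ` A)" "y \<in> co_set A"
  shows "C_tilde A C y = ereal (envelope A C y)"
  unfolding C_tilde_def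
  by (rule co_fun_eq_envelope[OF assms]) simp_all

lemma R_tilde_eq_envelope:
  assumes "bdd_below ((\<lambda>y. - R y) ` Q)" "y \<in> co_set Q"
  shows "R_tilde Q R y = ereal (- envelope Q (\<lambda>y. - R y) y)"
proof -
  have "co_fun (\<lambda>y. - (if y \<in> Q then ereal (R y) else -\<infinity>)) y = ereal (envelope Q (\<lambda>y. - R y) y)"
    by (rule co_fun_eq_envelope[OF assms]) simp_all
  then show ?thesis unfolding R_tilde_def by simp
qed

section \<open>Objectives as differences of nonnegative integrals\<close>

text \<open>
  Controls are arbitrary at negative times, so measurability on the whole line is guaranteed only after
  multiplication with the indicator of the half line.
\<close>
lemma half_line_measurable:
  fixes u :: "real \<Rightarrow> real"
  assumes "u \<in> borel_measurable (restrict_space borel {0..})"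
  shows "(\<lambda>t. ennreal (u t) * indicator {0..} t) \<in> borel_measurable lborel"
proof -
  have "(\<lambda>t. indicator {0..} t *\<^sub>R u t) \<in> borel_measurable borel"
    using assms by (subst (asm) borel_measurable_restrict_space_iff) auto
  then have "(\<lambda>t. ennreal (indicator {0..} t *\<^sub>R u t)) \<in> borel_measurable lborel"
    by measurable
  also have "(\<lambda>t. ennreal (indicator {0..} t *\<^sub>R u t)) = (\<lambda>t. ennreal (u t) * indicator {0..} t)"
    by (auto simp: fun_eq_iff split: split_indicator)
  finally show ?thesis .
qed

text \<open>
  The positive and negative parts of \<open>u - w\<close> satisfy \<open>u + (u - w)\<^sup>- = w + (u -
  w)\<^sup>+\<close>. Integrating gives the claim, since finiteness of the integral of \<open>u\<close>
  makes the subtraction legitimate even when \<open>w\<close> has infinite integral.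
\<close>
lemma ext_integral_diff:
  fixes u w :: "real \<Rightarrow> real"
  assumes u: "u \<in> borel_measurable (restrict_space borel {0..})" "\<And>t. 0 \<le> t \<Longrightarrow> 0 \<le> u t"
    and w: "w \<in> borel_measurable (restrict_space borel {0..})" "\<And>t. 0 \<le> t \<Longrightarrow> 0 \<le> w t"
    and fin: "(\<integral>\<^sup>+t\<in>{0..}. ennreal (u t) \<partial>lborel) < \<infinity>"
    and g: "\<And>t. 0 \<le> t \<Longrightarrow> g t = ereal (u t - w t)"
  shows "ext_integral g = enn2ereal (\<integral>\<^sup>+t\<in>{0..}. ennreal (u t) \<partial>lborel)
    - enn2ereal (\<integral>\<^sup>+t\<in>{0..}. ennreal (w t) \<partial>lborel)"
proof -
  let ?U = "\<integral>\<^sup>+t\<in>{0..}. ennreal (u t) \<partial>lborel" and ?W = "\<integral>\<^sup>+t\<in>{0..}. ennreal (w t) \<partial>lborel"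
  let ?P = "\<integral>\<^sup>+t\<in>{0..}. ennreal (u t - w t) \<partial>lborel" and ?N = "\<integral>\<^sup>+t\<in>{0..}. ennreal (w t - u t) \<partial>lborel"
  have diff: "(\<lambda>t. u t - w t) \<in> borel_measurable (restrict_space borel {0..})"
    "(\<lambda>t. w t - u t) \<in> borel_measurable (restrict_space borel {0..})"
    using u(1) w(1) by auto
  have "?U + ?N = (\<integral>\<^sup>+t. ennreal (u t) * indicator {0..} t + ennreal (w t - u t) * indicator {0..} t \<partial>lborel)"
    by (rule nn_integral_add[symmetric]) (intro half_line_measurable u diff)+
  also have "\<dots> = (\<integral>\<^sup>+t. ennreal (w t) * indicator {0..} t + ennreal (u t - w t) * indicator {0..} t \<partial>lborel)"
  proof (rule nn_integral_cong)
    fix t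
    show "ennreal (u t) * indicator {0..} t + ennreal (w t - u t) * indicator {0..} t =
      ennreal (w t) * indicator {0..} t + ennreal (u t - w t) * indicator {0..} t"
    proof (cases "0 \<le> t")
      case True
      then show ?thesis using u(2)[OF True] w(2)[OF True]
        by (cases "u t \<le> w t") (auto simp: ennreal_neg ennreal_plus[symmetric] simp del: ennreal_plus)
    qed simp
  qed
  also have "\<dots> = ?W + ?P"
    by (rule nn_integral_add) (intro half_line_measurable w diff)+
  finally have bal: "?U + ?N = ?W + ?P" .
  have "?P \<le> ?U"
    using w(2) by (intro nn_integral_mono) (simp add: ennreal_leI split: split_indicator)
  then have "?P < \<infinity>" using fin by (rule order.strict_trans1)
  have "(\<integral>\<^sup>+t\<in>{0..}. e2ennreal (g t) \<partial>lborel) = ?P"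
    by (intro nn_integral_cong) (auto simp: g ennreal.rep_eq e2ennreal_ereal split: split_indicator)
  moreover have "(\<integral>\<^sup>+t\<in>{0..}. e2ennreal (- g t) \<partial>lborel) = ?N"
    by (intro nn_integral_cong) (auto simp: g ennreal.rep_eq e2ennreal_ereal split: split_indicator)
  ultimately have "ext_integral g = enn2ereal ?P - enn2ereal ?N"
    unfolding ext_integral_def by simp
  also have "\<dots> = enn2ereal ?U - enn2ereal ?W"
    using bal fin \<open>?P < \<infinity>\<close>
    by (cases ?U rule: ennreal_cases; cases ?W rule: ennreal_cases; cases ?P rule: ennreal_cases;
        cases ?N rule: ennreal_cases)
      (auto simp: ennreal_plus[symmetric] simp del: ennreal_plus)
  finally show ?thesis .
qed

lemma nn_integral_discount:
  assumes "0 < \<beta>"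
  shows "(\<integral>\<^sup>+t\<in>{0..}. ennreal (exp (- \<beta> * t)) \<partial>lborel) = ennreal (1 / \<beta>)"
proof -
  have "((\<lambda>t. - exp (- \<beta> * t) / \<beta>) \<longlongrightarrow> 0) at_top"
    using assms by real_asymp
  then have "(\<integral>\<^sup>+t. ennreal (exp (- \<beta> * t)) * indicator {0..} t \<partial>lborel) = 0 - (- exp (- \<beta> * 0) / \<beta>)"
    using assms by (intro nn_integral_FTC_atLeast) (auto intro!: derivative_eq_intros)
  then show ?thesis by simp
qed

section \<open>Local integrability and discounted integrals on a grid\<close>

text \<open>
  Half-open, so that the cells are disjoint and cover the half line including \<open>0\<close>.
\<close>
definition cell :: "real \<Rightarrow> nat \<Rightarrow> real set" where
  "cell h k = {real k * h..<(real k + 1) * h}"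

lemma cell_borel [measurable]: "cell h k \<in> sets borel"
  by (simp add: cell_def)

lemma mem_cell_iff:
  assumes "0 < h"
  shows "t \<in> cell h k \<longleftrightarrow> 0 \<le> t \<and> nat \<lfloor>t / h\<rfloor> = k"
proof -
  have "t \<in> cell h k \<longleftrightarrow> real k \<le> t / h \<and> t / h < real k + 1"
    using assms by (simp add: cell_def field_simps)
  also have "\<dots> \<longleftrightarrow> \<lfloor>t / h\<rfloor> = int k"
    by (simp add: floor_eq_iff)
  also have "\<dots> \<longleftrightarrow> 0 \<le> t \<and> nat \<lfloor>t / h\<rfloor> = k"
  proof
    assume "\<lfloor>t / h\<rfloor> = int k"
    then have "0 \<le> t / h" by linarith
    then show "0 \<le> t \<and> nat \<lfloor>t / h\<rfloor> = k"
      using assms \<open>\<lfloor>t / h\<rfloor> = int k\<close> by (simp add: zero_le_divide_iff)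
  next
    assume "0 \<le> t \<and> nat \<lfloor>t / h\<rfloor> = k"
    moreover from this have "0 \<le> \<lfloor>t / h\<rfloor>" using assms by simp
    ultimately show "\<lfloor>t / h\<rfloor> = int k" by linarith
  qed
  finally show ?thesis .
qed

lemma cell_nonneg: "0 < h \<Longrightarrow> t \<in> cell h k \<Longrightarrow> 0 \<le> t"
  by (simp add: mem_cell_iff)

lemma UN_cell: "0 < h \<Longrightarrow> (\<Union>k. cell h k) = {0..}"
  by (auto simp: mem_cell_iff)

lemma disjoint_cells: "0 < h \<Longrightarrow> disjoint_family (cell h)"
  by (auto simp: disjoint_family_on_def mem_cell_iff)

lemma locally_integrable_iff_cells:
  assumes "0 < h"
  shows "locally_integrable f \<longleftrightarrow> (\<forall>k. set_integrable lborel (cell h k) f)"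
proof
  assume f: "locally_integrable f"
  show "\<forall>k. set_integrable lborel (cell h k) f"
  proof
    fix k
    have "cell h k \<subseteq> {0..(real k + 1) * h}"
      using assms cell_nonneg[OF assms] by (auto simp: cell_def)
    moreover have "set_integrable lborel {0..(real k + 1) * h} f"
      using f assms by (simp add: locally_integrable_def)
    ultimately show "set_integrable lborel (cell h k) f"
      by (rule set_integrable_subset[rotated 2]) simp
  qed
next
  assume f: "\<forall>k. set_integrable lborel (cell h k) f"
  show "locally_integrable f"
    unfolding locally_integrable_def
  proof (intro allI impI)
    fix T :: real assume "0 \<le> T"
    let ?n = "nat \<lfloor>T / h\<rfloor>"
    have "set_integrable lborel (\<Union>k\<in>{..?n}. cell h k) f"
      using f by (intro set_integrable_UN) auto
    moreover have "{0..T} \<subseteq> (\<Union>k\<in>{..?n}. cell h k)"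
      using assms by (auto simp: mem_cell_iff intro!: nat_mono floor_mono divide_right_mono)
    ultimately show "set_integrable lborel {0..T} f"
      by - (rule set_integrable_subset, assumption, simp, assumption)
  qed
qed

lemma set_nn_integral_eq_set_integral:
  fixes f :: "real \<Rightarrow> real"
  assumes "set_integrable lborel B f" "\<And>t. t \<in> B \<Longrightarrow> 0 \<le> f t"
  shows "(\<integral>\<^sup>+t\<in>B. ennreal (f t) \<partial>lborel) = ennreal (LBINT t:B. f t)"
proof -
  have "(\<integral>\<^sup>+t\<in>B. ennreal (f t) \<partial>lborel) = (\<integral>\<^sup>+t. ennreal (indicator B t *\<^sub>R f t) \<partial>lborel)"
    by (intro nn_integral_cong) (auto split: split_indicator)
  also have "\<dots> = ennreal (LBINT t:B. f t)"
    unfolding set_lebesgue_integral_def using assms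
    by (intro nn_integral_eq_integral) (auto simp: set_integrable_def split: split_indicator)
  finally show ?thesis .
qed

text \<open>
  Within a cell the discount factor varies by a factor of at most \<open>exp (\<beta> * h)\<close>.
  Undiscounted inequalities cell by cell therefore sum up to a discounted one with this constant. For the
  cost the roles of \<open>f\<close> and \<open>g\<close> are taken by the new and the old control, for
  the revenue by the old and the new one.
\<close>
lemma discounted_integral_le:
  fixes f g :: "real \<Rightarrow> real"
  assumes h: "0 < h" and \<beta>: "0 < \<beta>"
    and f: "f \<in> borel_measurable (restrict_space borel {0..})" "\<And>t. 0 \<le> t \<Longrightarrow> 0 \<le> f t"
      "\<And>k. set_integrable lborel (cell h k) f"
    and g: "g \<in> borel_measurable (restrict_space borel {0..})" "\<And>t. 0 \<le> t \<Longrightarrow> 0 \<le> g t"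
      "\<And>k. set_integrable lborel (cell h k) g"
    and le: "\<And>k. (LBINT t:cell h k. f t) \<le> (LBINT t:cell h k. g t)"
  shows "(\<integral>\<^sup>+t\<in>{0..}. ennreal (exp (- \<beta> * t) * f t) \<partial>lborel)
    \<le> ennreal (exp (\<beta> * h)) * (\<integral>\<^sup>+t\<in>{0..}. ennreal (exp (- \<beta> * t) * g t) \<partial>lborel)"
proof -
  let ?D = "\<lambda>f t. ennreal (exp (- \<beta> * t) * f t) * indicator {0..} t"
  have meas: "?D u \<in> borel_measurable lborel"
    if "u \<in> borel_measurable (restrict_space borel {0..})" for u
    using that by (intro half_line_measurable borel_measurable_times borel_measurable_exp
        borel_measurable_times) (auto intro!: measurable_restrict_space1)
  have split: "(\<integral>\<^sup>+t\<in>{0..}. ennreal (exp (- \<beta> * t) * u t) \<partial>lborel)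
      = (\<Sum>k. \<integral>\<^sup>+t\<in>cell h k. ennreal (exp (- \<beta> * t) * u t) \<partial>lborel)"
    if "u \<in> borel_measurable (restrict_space borel {0..})" for u
  proof -
    have "(\<integral>\<^sup>+t\<in>{0..}. ennreal (exp (- \<beta> * t) * u t) \<partial>lborel) = (\<integral>\<^sup>+t\<in>(\<Union>k. cell h k). ?D u t \<partial>lborel)"
      unfolding UN_cell[OF h] by (intro nn_integral_cong) (auto split: split_indicator)
    also have "\<dots> = (\<Sum>k. \<integral>\<^sup>+t\<in>cell h k. ?D u t \<partial>lborel)"
      by (rule nn_integral_disjoint_family[OF meas[OF that] _ disjoint_cells[OF h]]) simp
    also have "\<dots> = (\<Sum>k. \<integral>\<^sup>+t\<in>cell h k. ennreal (exp (- \<beta> * t) * u t) \<partial>lborel)"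
      using cell_nonneg[OF h]
      by (intro suminf_cong nn_integral_cong) (auto split: split_indicator)
    finally show ?thesis .
  qed
  have piece: "(\<integral>\<^sup>+t\<in>cell h k. ennreal (exp (- \<beta> * t) * f t) \<partial>lborel)
      \<le> ennreal (exp (\<beta> * h)) * (\<integral>\<^sup>+t\<in>cell h k. ennreal (exp (- \<beta> * t) * g t) \<partial>lborel)" for k
  proof -
    let ?a = "exp (- \<beta> * (real k * h))"
    have "(\<integral>\<^sup>+t\<in>cell h k. ennreal (exp (- \<beta> * t) * f t) \<partial>lborel)
        \<le> (\<integral>\<^sup>+t\<in>cell h k. ennreal (?a * f t) \<partial>lborel)"
      using \<beta> f(2)[OF cell_nonneg[OF h]]
      by (intro nn_integral_mono) (auto simp: cell_def split: split_indicator intro!: ennreal_leI mult_right_mono)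
    also have "\<dots> = ennreal (LBINT t:cell h k. ?a * f t)"
      using f(2)[OF cell_nonneg[OF h]] f(3)
      by (intro set_nn_integral_eq_set_integral) auto
    also have "\<dots> \<le> ennreal (LBINT t:cell h k. ?a * g t)"
      using le[of k] by (intro ennreal_leI) simp
    also have "\<dots> = (\<integral>\<^sup>+t\<in>cell h k. ennreal (?a * g t) \<partial>lborel)"
      using g(2)[OF cell_nonneg[OF h]] g(3)
      by (intro set_nn_integral_eq_set_integral[symmetric]) auto
    also have "\<dots> \<le> (\<integral>\<^sup>+t. ennreal (exp (\<beta> * h)) * (ennreal (exp (- \<beta> * t) * g t) * indicator (cell h k) t) \<partial>lborel)"
    proof (rule nn_integral_mono)
      fix t
      show "ennreal (?a * g t) * indicator (cell h k) t
        \<le> ennreal (exp (\<beta> * h)) * (ennreal (exp (- \<beta> * t) * g t) * indicator (cell h k) t)"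
      proof (cases "t \<in> cell h k")
        case True
        then have "t \<le> real k * h + h" by (simp add: cell_def algebra_simps)
        then have "\<beta> * t \<le> \<beta> * (real k * h + h)" using \<beta> by (intro mult_left_mono) auto
        then have "?a \<le> exp (\<beta> * h) * exp (- \<beta> * t)"
          by (simp add: exp_add[symmetric] algebra_simps)
        then have "?a * g t \<le> exp (\<beta> * h) * exp (- \<beta> * t) * g t"
          using g(2)[OF cell_nonneg[OF h True]] by (rule mult_right_mono)
        then show ?thesis using True
          by (simp add: ennreal_mult'[symmetric] mult.assoc ennreal_leI)
      qed simp
    qed
    also have "\<dots> = ennreal (exp (\<beta> * h)) * (\<integral>\<^sup>+t\<in>cell h k. ennreal (exp (- \<beta> * t) * g t) \<partial>lborel)"
    proof (rule nn_integral_cmult)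
      have "(\<lambda>t. ?D g t * indicator (cell h k) t) \<in> borel_measurable lborel"
        using meas[OF g(1)] by measurable
      moreover have "(\<lambda>t. ?D g t * indicator (cell h k) t)
          = (\<lambda>t. ennreal (exp (- \<beta> * t) * g t) * indicator (cell h k) t)"
        using cell_nonneg[OF h] by (auto simp: fun_eq_iff split: split_indicator)
      ultimately show "(\<lambda>t. ennreal (exp (- \<beta> * t) * g t) * indicator (cell h k) t) \<in> borel_measurable lborel"
        by simp
    qed
    finally show ?thesis .
  qed
  show ?thesis
    unfolding split[OF f(1)] split[OF g(1)] ennreal_suminf_cmult[symmetric]
    by (intro suminf_le piece) auto
qed

text \<open>
  The mean of a relaxed production control may integrate an unbounded function, so its measurability in
  time does not follow from the definition of a relaxed control; it comes with local integrability.
\<close>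
lemma borel_measurable_of_locally_integrable:
  assumes "locally_integrable f"
  shows "f \<in> borel_measurable (restrict_space borel {0..})"
proof -
  have "(\<lambda>t. indicator {0..} t *\<^sub>R f t) \<in> borel_measurable borel"
  proof (rule borel_measurable_LIMSEQ_real)
    fix n :: nat
    have "set_integrable lborel {0..real n} f" using assms by (simp add: locally_integrable_def)
    then show "(\<lambda>t. indicator {0..real n} t *\<^sub>R f t) \<in> borel_measurable borel"
      unfolding set_integrable_def by (simp add: borel_measurable_integrable)
  next
    fix t :: real
    have "\<forall>\<^sub>F n in sequentially. t \<le> real n"
      by (rule eventually_at_top_linorderI[of "nat \<lceil>t\<rceil>"]) linarith
    then have "\<forall>\<^sub>F n in sequentially. indicator {0..real n} t *\<^sub>R f t = indicator {0..} t *\<^sub>R f t"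
      by eventually_elim (auto split: split_indicator)
    then show "(\<lambda>n. indicator {0..real n} t *\<^sub>R f t) \<longlonglongrightarrow> indicator {0..} t *\<^sub>R f t"
      by (rule tendsto_eventually)
  qed
  then show ?thesis by (subst borel_measurable_restrict_space_iff) auto
qed

lemma locally_integrable_bounded:
  fixes f :: "real \<Rightarrow> real"
  assumes f: "f \<in> borel_measurable (restrict_space borel {0..})" and B: "\<And>t. 0 \<le> t \<Longrightarrow> \<bar>f t\<bar> \<le> B"
  shows "locally_integrable f"
  unfolding locally_integrable_def
proof (intro allI impI)
  fix T :: real assume "0 \<le> T"
  have m: "(\<lambda>t. indicator {0..} t *\<^sub>R f t) \<in> borel_measurable borel"
    using f by (subst (asm) borel_measurable_restrict_space_iff) auto
  have "(\<lambda>t. indicator {0..T} t *\<^sub>R (indicator {0..} t *\<^sub>R f t)) \<in> borel_measurable lborel"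
    using m by measurable
  also have "(\<lambda>t. indicator {0..T} t *\<^sub>R (indicator {0..} t *\<^sub>R f t)) = (\<lambda>t. indicator {0..T} t *\<^sub>R f t)"
    by (auto simp: fun_eq_iff split: split_indicator)
  finally have m': "(\<lambda>t. indicator {0..T} t *\<^sub>R f t) \<in> borel_measurable lborel" .
  have "integrable lborel (\<lambda>t. indicator {0..T} t *\<^sub>R B)"
    by (rule integrable_scaleR_left, rule integrable_real_indicator) (simp_all add: \<open>0 \<le> T\<close>)
  then show "set_integrable lborel {0..T} f"
    unfolding set_integrable_def
    by (rule Bochner_Integration.integrable_bound[OF _ m'])
      (use B in \<open>auto split: split_indicator intro!: AE_I2 intro: order_trans[OF _ abs_ge_self]\<close>)
qed

lemma locally_integrable_diff:
  assumes "locally_integrable f" "locally_integrable g"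
  shows "locally_integrable (\<lambda>t. f t - g t)"
  using assms unfolding locally_integrable_def by (auto intro: set_integral_diff(1))

lemma measurable_discounted:
  fixes u :: "real \<Rightarrow> real"
  assumes "u \<in> borel_measurable (restrict_space borel {0..})"
  shows "(\<lambda>t. exp (- \<beta> * t) * u t) \<in> borel_measurable (restrict_space borel {0..})"
  by (intro borel_measurable_times assms) (auto intro!: measurable_restrict_space1)

text \<open>
  This turns a running tolerance, which is what nearly optimal chords provide, into a bound on the
  objective.
\<close>
lemma nn_integral_discounted_add_const:
  fixes u :: "real \<Rightarrow> real"
  assumes "0 < \<beta>" "0 \<le> \<epsilon>" and u: "u \<in> borel_measurable (restrict_space borel {0..})"
    and nn: "\<And>t. 0 \<le> t \<Longrightarrow> 0 \<le> u t"
  shows "(\<integral>\<^sup>+t\<in>{0..}. ennreal (exp (- \<beta> * t) * (u t + \<epsilon>)) \<partial>lborel)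
    = (\<integral>\<^sup>+t\<in>{0..}. ennreal (exp (- \<beta> * t) * u t) \<partial>lborel) + ennreal (\<epsilon> / \<beta>)"
proof -
  have "(\<integral>\<^sup>+t\<in>{0..}. ennreal (exp (- \<beta> * t) * (u t + \<epsilon>)) \<partial>lborel)
     = (\<integral>\<^sup>+t. ennreal (exp (- \<beta> * t) * u t) * indicator {0..} t
          + ennreal \<epsilon> * (ennreal (exp (- \<beta> * t)) * indicator {0..} t) \<partial>lborel)"
    using nn assms(2)
    by (intro nn_integral_cong)
      (auto split: split_indicator simp: ennreal_mult'[symmetric] ennreal_plus[symmetric] algebra_simps
        simp del: ennreal_plus)
  also have "\<dots> = (\<integral>\<^sup>+t\<in>{0..}. ennreal (exp (- \<beta> * t) * u t) \<partial>lborel)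
      + (\<integral>\<^sup>+t. ennreal \<epsilon> * (ennreal (exp (- \<beta> * t)) * indicator {0..} t) \<partial>lborel)"
    by (intro nn_integral_add half_line_measurable measurable_discounted u) simp
  also have "(\<integral>\<^sup>+t. ennreal \<epsilon> * (ennreal (exp (- \<beta> * t)) * indicator {0..} t) \<partial>lborel)
      = ennreal \<epsilon> * ennreal (1 / \<beta>)"
    using nn_integral_discount[OF assms(1)] by (simp add: nn_integral_cmult)
  also have "\<dots> = ennreal (\<epsilon> / \<beta>)"
    using assms by (simp add: ennreal_mult'[symmetric])
  finally show ?thesis .
qed

text \<open>
  On a bounded time interval the discount factor is bounded away from zero.
\<close>
lemma set_integrable_cell_of_discounted:
  fixes u :: "real \<Rightarrow> real"
  assumes h: "0 < h" and \<beta>: "0 < \<beta>" and u: "u \<in> borel_measurable (restrict_space borel {0..})"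
    and nn: "\<And>t. 0 \<le> t \<Longrightarrow> 0 \<le> u t"
    and fin: "(\<integral>\<^sup>+t\<in>{0..}. ennreal (exp (- \<beta> * t) * u t) \<partial>lborel) < \<infinity>"
  shows "set_integrable lborel (cell h k) u"
proof -
  have m: "(\<lambda>t. indicator {0..} t *\<^sub>R u t) \<in> borel_measurable borel"
    using u by (subst (asm) borel_measurable_restrict_space_iff) auto
  then have "(\<lambda>t. exp (- \<beta> * t) * (indicator {0..} t *\<^sub>R u t)) \<in> borel_measurable lborel"
    by measurable
  moreover have "(\<integral>\<^sup>+t. ennreal (norm (exp (- \<beta> * t) * (indicator {0..} t *\<^sub>R u t))) \<partial>lborel)
      = (\<integral>\<^sup>+t\<in>{0..}. ennreal (exp (- \<beta> * t) * u t) \<partial>lborel)"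
    using nn by (intro nn_integral_cong) (auto split: split_indicator)
  ultimately have int: "integrable lborel (\<lambda>t. exp (- \<beta> * t) * (indicator {0..} t *\<^sub>R u t))"
    using fin by (intro integrableI_bounded) auto
  let ?E = "exp (\<beta> * ((real k + 1) * h))"
  show ?thesis
    unfolding set_integrable_def
  proof (rule Bochner_Integration.integrable_bound[OF integrable_mult_right[OF int, of ?E]])
    have "(\<lambda>t. indicator (cell h k) t *\<^sub>R (indicator {0..} t *\<^sub>R u t)) \<in> borel_measurable lborel"
      using m by measurable
    also have "(\<lambda>t. indicator (cell h k) t *\<^sub>R (indicator {0..} t *\<^sub>R u t)) = (\<lambda>t. indicator (cell h k) t *\<^sub>R u t)"
      using cell_nonneg[OF h] by (auto simp: fun_eq_iff split: split_indicator)
    finally show "(\<lambda>t. indicator (cell h k) t *\<^sub>R u t) \<in> borel_measurable lborel" .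
    show "AE t in lborel. norm (indicator (cell h k) t *\<^sub>R u t)
        \<le> norm (?E * (exp (- \<beta> * t) * (indicator {0..} t *\<^sub>R u t)))"
    proof (rule AE_I2)
      fix t
      show "norm (indicator (cell h k) t *\<^sub>R u t)
        \<le> norm (?E * (exp (- \<beta> * t) * (indicator {0..} t *\<^sub>R u t)))"
      proof (cases "t \<in> cell h k")
        case True
        then have t: "0 \<le> t" using cell_nonneg[OF h] by blast
        have "\<beta> * t \<le> \<beta> * ((real k + 1) * h)"
          using True \<beta> by (intro mult_left_mono) (auto simp: cell_def)
        then have "1 \<le> ?E * exp (- \<beta> * t)" by (simp add: exp_add[symmetric])
        then have "1 * u t \<le> ?E * exp (- \<beta> * t) * u t" using nn[OF t] by (rule mult_right_mono)
        then show ?thesis using True t nn[OF t] by (simp add: abs_mult mult.assoc)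
      qed simp
    qed
  qed
qed

lemma state_split:
  assumes "locally_integrable \<alpha>" "locally_integrable q" "0 \<le> t"
  shows "(LBINT s:{0..t}. \<alpha> s - q s) = (LBINT s:{0..t}. \<alpha> s) - (LBINT s:{0..t}. q s)"
  using assms by (auto simp: locally_integrable_def intro: set_integral_diff(2))

section \<open>Switching controls and the state constraint\<close>

text \<open>
  The two-level control behind chattering. Production and sales use the same construction with the levels
  in opposite orders.
\<close>
definition switching :: "real \<Rightarrow> (nat \<Rightarrow> real) \<Rightarrow> (nat \<Rightarrow> real) \<Rightarrow> (nat \<Rightarrow> real) \<Rightarrow> real \<Rightarrow> real" where
  "switching h p u v t =
     (let k = nat \<lfloor>t / h\<rfloor> in if t < (real k + p k) * h then u k else v k)"

lemma switching_borel_measurable: "switching h p u v \<in> borel_measurable borel"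
  unfolding switching_def[abs_def] Let_def
  by (rule measurable_compose_countable[where f = "\<lambda>k t. if t < (real k + p k) * h then u k else v k"])
    measurable

lemma switching_in: "(\<And>k. u k \<in> S) \<Longrightarrow> (\<And>k. v k \<in> S) \<Longrightarrow> switching h p u v t \<in> S"
  by (simp add: switching_def Let_def)

lemma switching_on_cell:
  assumes "0 < h" "t \<in> cell h k"
  shows "switching h p u v t = (if t < (real k + p k) * h then u k else v k)"
  using assms by (simp add: switching_def mem_cell_iff)

lemma switching_cell_integral:
  fixes \<phi> :: "real \<Rightarrow> real"
  assumes h: "0 < h" and p: "0 \<le> p k" "p k \<le> 1"
  shows "set_integrable lborel (cell h k) (\<lambda>t. \<phi> (switching h p u v t))"
    and "(LBINT t:cell h k. \<phi> (switching h p u v t)) = h * (p k * \<phi> (u k) + (1 - p k) * \<phi> (v k))"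
proof -
  let ?a = "real k * h" and ?b = "(real k + p k) * h" and ?c = "(real k + 1) * h"
  have ord: "?a \<le> ?b" "?b \<le> ?c" using h p by (auto intro!: mult_right_mono)
  have eq: "indicator (cell h k) t *\<^sub>R \<phi> (switching h p u v t)
      = indicator {?a..<?b} t *\<^sub>R \<phi> (u k) + indicator {?b..<?c} t *\<^sub>R \<phi> (v k)" for t
  proof (cases "t \<in> cell h k")
    case True
    then show ?thesis
      using switching_on_cell[OF h True, of p u v] by (auto simp: cell_def split: split_indicator)
  next
    case False
    then have "t \<notin> {?a..<?b}" "t \<notin> {?b..<?c}" using ord by (auto simp: cell_def)
    then show ?thesis using False by simp
  qed
  have "has_bochner_integral lborel
      (\<lambda>t. indicator {?a..<?b} t *\<^sub>R \<phi> (u k) + indicator {?b..<?c} t *\<^sub>R \<phi> (v k))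
      (measure lborel {?a..<?b} *\<^sub>R \<phi> (u k) + measure lborel {?b..<?c} *\<^sub>R \<phi> (v k))"
    by (intro has_bochner_integral_add has_bochner_integral_scaleR_left has_bochner_integral_real_indicator)
      (use ord in auto)
  moreover have "measure lborel {?a..<?b} *\<^sub>R \<phi> (u k) + measure lborel {?b..<?c} *\<^sub>R \<phi> (v k)
      = h * (p k * \<phi> (u k) + (1 - p k) * \<phi> (v k))"
    using ord by (simp add: algebra_simps)
  ultimately have "has_bochner_integral lborel (\<lambda>t. indicator (cell h k) t *\<^sub>R \<phi> (switching h p u v t))
      (h * (p k * \<phi> (u k) + (1 - p k) * \<phi> (v k)))"
    unfolding eq by simp
  then show "set_integrable lborel (cell h k) (\<lambda>t. \<phi> (switching h p u v t))"
    "(LBINT t:cell h k. \<phi> (switching h p u v t)) = h * (p k * \<phi> (u k) + (1 - p k) * \<phi> (v k))"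
    unfolding set_integrable_def set_lebesgue_integral_def
    by (auto simp: has_bochner_integral_iff)
qed

text \<open>
  The average of \<open>X\<close> over a cell lies in \<open>co_set S\<close>. Jensen's inequality bounds
  the envelope there by the average of the envelope along \<open>X\<close>, and a nearly optimal chord
  supplies two levels in \<open>S\<close> with the same average.
\<close>
lemma near_optimal_switching:
  assumes h: "0 < h" and \<epsilon>: "0 < \<epsilon>" and bd: "bdd_below (f ` S)"
    and XS: "\<And>t. 0 \<le> t \<Longrightarrow> X t \<in> co_set S"
    and X: "\<And>k. set_integrable lborel (cell h k) X"
    and fX: "\<And>k. set_integrable lborel (cell h k) (\<lambda>t. envelope S f (X t))"
  obtains p a b where "\<And>k. a k \<in> S" "\<And>k. b k \<in> S" "\<And>k. a k \<le> b k" "\<And>k. 0 \<le> p k" "\<And>k. p k \<le> (1::real)"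
    "\<And>k. h * (p k * a k + (1 - p k) * b k) = (LBINT t:cell h k. X t)"
    "\<And>k. h * (p k * f (a k) + (1 - p k) * f (b k)) \<le> (LBINT t:cell h k. envelope S f (X t)) + h * \<epsilon>"
proof -
  have "\<exists>p a b. a \<in> S \<and> b \<in> S \<and> a \<le> b \<and> 0 \<le> p \<and> p \<le> 1
    \<and> h * (p * a + (1 - p) * b) = (LBINT t:cell h k. X t)
    \<and> h * (p * f a + (1 - p) * f b) \<le> (LBINT t:cell h k. envelope S f (X t)) + h * \<epsilon>" for k
  proof -
    let ?M = "restrict_space lborel (cell h k)"
    have em: "emeasure ?M (space ?M) = ennreal h"
      using h by (simp add: emeasure_restrict_space space_restrict_space cell_def
          mult_right_mono algebra_simps)
    have fin: "finite_measure ?M"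
      by (rule finite_measureI) (subst em, simp)
    have mh: "measure ?M (space ?M) = h"
      using h em by (simp add: measure_def)
    have int: "integrable ?M u \<longleftrightarrow> set_integrable lborel (cell h k) u" for u :: "real \<Rightarrow> real"
      unfolding set_integrable_def by (rule integrable_restrict_space) simp
    have lint: "(\<integral>t. u t \<partial>?M) = (LBINT t:cell h k. u t)" for u :: "real \<Rightarrow> real"
      unfolding set_lebesgue_integral_def by (rule integral_restrict_space) simp
    have XM: "X t \<in> co_set S" if "t \<in> space ?M" for t
      using that by (intro XS cell_nonneg[OF h]) (simp add: space_restrict_space)
    define m where "m = (LBINT t:cell h k. X t) / h"
    have "m \<in> co_set S"
      using mean_in_interval[OF fin _ _ XM is_interval_co_set, unfolded mh lint int] h X
      by (simp add: m_def)
    then obtain p a b where pab: "a \<in> S" "b \<in> S" "a \<le> b" "0 \<le> p" "p \<le> 1"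
      "p * a + (1 - p) * b = m" "p * f a + (1 - p) * f b \<le> envelope S f m + \<epsilon>"
      using near_optimal_chord[OF _ \<epsilon>] by blast
    have "h * (p * f a + (1 - p) * f b) \<le> h * (envelope S f m + \<epsilon>)"
      using h by (intro mult_left_mono pab) simp
    also have "\<dots> = h * envelope S f m + h * \<epsilon>" by (simp add: algebra_simps)
    also have "h * envelope S f m \<le> (LBINT t:cell h k. envelope S f (X t))"
      using envelope_Jensen[OF fin _ _ XM bd _ order.refl, unfolded mh lint int] h X fX
      by (simp add: m_def)
    finally show ?thesis
      using pab h by (intro exI[of _ p] exI[of _ a] exI[of _ b]) (simp add: m_def)
  qed
  then show ?thesis using that by metis
qed

lemma set_integral_split:
  fixes f :: "real \<Rightarrow> real"
  assumes f: "locally_integrable f" and st: "0 \<le> s" "s \<le> t"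
  shows "(LBINT r:{0..t}. f r) = (LBINT r:{0..s}. f r) + (LBINT r:{s<..t}. f r)"
proof -
  have ft: "set_integrable lborel {0..t} f"
    using f st by (auto simp: locally_integrable_def)
  have "(LBINT r:{0..s} \<union> {s<..t}. f r) = (LBINT r:{0..s}. f r) + (LBINT r:{s<..t}. f r)"
    by (intro set_integral_Un set_integrable_subset[OF ft]) (use st in auto)
  moreover have "{0..s} \<union> {s<..t} = {0..t}" using st by auto
  ultimately show ?thesis by simp
qed

lemma set_integral_cell:
  fixes f :: "real \<Rightarrow> real"
  assumes h: "0 < h" and f: "locally_integrable f"
  shows "(LBINT r:{real k * h<..(real k + 1) * h}. f r) = (LBINT r:cell h k. f r)"
proof -
  let ?I = "{real k * h..(real k + 1) * h}"
  have "set_integrable lborel {0..(real k + 1) * h} f"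
    using f h by (simp add: locally_integrable_def)
  then have I: "set_integrable lborel ?I f"
    by (rule set_integrable_subset) (use h in auto)
  have *: "set_borel_measurable lborel B f" if "B \<subseteq> ?I" "B \<in> sets lborel" for B
    using set_integrable_subset[OF I that(2,1)]
    by (simp add: set_integrable_def set_borel_measurable_def)
  show ?thesis
  proof (rule set_integral_cong_set)
    have "AE r in lborel. r \<notin> {real k * h, (real k + 1) * h}"
      by (intro AE_not_in finite_imp_null_set_lborel) simp
    then show "AE r in lborel. (r \<in> cell h k) = (r \<in> {real k * h<..(real k + 1) * h})"
      by eventually_elim (auto simp: cell_def)
  qed (intro *; auto simp: cell_def)+
qed

text \<open>
  Both states agree at the grid points. Inside a cell the rate \<open>d\<close> is nonincreasing: if it
  is nonnegative at \<open>t\<close>, it has been so since the left end of the cell and the state has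
  grown since then; otherwise it stays nonpositive up to the right end, and the state at \<open>t\<close>
  is at least the one there.
\<close>
lemma nonneg_of_nonneg_at_grid:
  fixes d d0 :: "real \<Rightarrow> real"
  assumes h: "0 < h" and d: "locally_integrable d" and d0: "locally_integrable d0"
    and eq: "\<And>k. (LBINT t:cell h k. d t) = (LBINT t:cell h k. d0 t)"
    and anti: "\<And>k s t. s \<in> cell h k \<Longrightarrow> t \<in> cell h k \<Longrightarrow> s \<le> t \<Longrightarrow> d t \<le> d s"
    and nn: "\<And>t. 0 \<le> t \<Longrightarrow> 0 \<le> x + (LBINT s:{0..t}. d0 s)"
    and t: "0 \<le> t"
  shows "0 \<le> x + (LBINT s:{0..t}. d s)"
proof -
  have grid: "(LBINT s:{0..real k * h}. d s) = (LBINT s:{0..real k * h}. d0 s)" for k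
  proof (induction k)
    case 0
    have "AE s in lborel. s \<noteq> (0::real)" by (rule AE_lborel_singleton)
    then have "(LBINT s:{0..0}. u s) = 0" for u :: "real \<Rightarrow> real"
      unfolding set_lebesgue_integral_def
      by (intro integral_eq_zero_AE) (auto elim!: eventually_mono)
    then show ?case by simp
  next
    case (Suc k)
    have le: "0 \<le> real k * h" "real k * h \<le> (real k + 1) * h"
      using h by (auto intro!: mult_right_mono)
    show ?case
      using set_integral_split[OF d le] set_integral_split[OF d0 le]
        set_integral_cell[OF h d, of k] set_integral_cell[OF h d0, of k] eq[of k] Suc.IH
      by (simp add: add.commute)
  qed
  define k where "k = nat \<lfloor>t / h\<rfloor>"
  let ?a = "real k * h" and ?b = "(real k + 1) * h"
  have tk: "t \<in> cell h k" using h t by (simp add: mem_cell_iff k_def)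
  then have tab: "0 \<le> ?a" "?a \<le> t" "t < ?b" using h by (auto simp: cell_def)
  have at_a: "0 \<le> x + (LBINT s:{0..?a}. d s)"
    using nn[of ?a] tab by (simp add: grid)
  have at_b: "0 \<le> x + (LBINT s:{0..?b}. d s)"
    using nn[of ?b] tab grid[of "Suc k"] by (simp add: add.commute)
  show ?thesis
  proof (cases "0 \<le> d t")
    case True
    have "0 \<le> d s" if "s \<in> {?a<..t}" for s
      using anti[of s k t] that True tab tk by (auto simp: cell_def)
    then have "0 \<le> (LBINT s:{?a<..t}. d s)"
      unfolding set_lebesgue_integral_def
      by (intro integral_nonneg_AE AE_I2) (auto split: split_indicator)
    then show ?thesis
      using at_a set_integral_split[OF d tab(1,2)] by simp
  next
    case False
    \<comment> \<open>The right end point belongs to the next cell, where the rate may jump up; it is a null set.\<close>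
    have "d s \<le> 0" if "s \<in> {t<..<?b}" for s
      using anti[of t k s] that False tab tk by (auto simp: cell_def)
    then have "AE s in lborel. 0 \<le> indicator {t<..?b} s *\<^sub>R (- d s)"
      using AE_lborel_singleton[of ?b] by (auto elim!: eventually_mono split: split_indicator)
    then have "0 \<le> (LBINT s:{t<..?b}. - d s)"
      unfolding set_lebesgue_integral_def by (rule integral_nonneg_AE)
    also have "\<dots> = - (LBINT s:{t<..?b}. d s)"
      unfolding set_lebesgue_integral_def by simp
    finally show ?thesis
      using at_b set_integral_split[OF d t less_imp_le[OF tab(3)]] by simp
  qed
qed

section \<open>Relaxed controls\<close>

lemma integrable_dirac:
  fixes a :: real
  assumes "a \<in> S"
  shows "integrable (return (restrict_space borel S) a) (\<lambda>y. y)"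
proof -
  have sp: "a \<in> space (restrict_space borel S)" using assms by (simp add: space_restrict_space)
  interpret prob_space "return (restrict_space borel S) a" by (rule prob_space_return[OF sp])
  have id: "(\<lambda>y::real. y) \<in> borel_measurable (restrict_space borel S)"
    by (intro measurable_restrict_space1) simp
  have "AE y in return (restrict_space borel S) a. norm y \<le> \<bar>a\<bar>"
    using id by (subst AE_return[OF sp]) auto
  then show ?thesis by (rule integrable_const_bound) (use id in simp)
qed

lemma relaxed_control_dirac:
  assumes a: "a \<in> restrict_space borel {0..} \<rightarrow>\<^sub>M restrict_space borel S"
  shows "relaxed_control S (\<lambda>t. return (restrict_space borel S) (a t))"
  unfolding relaxed_control_def
proof (intro conjI allI impI)
  fix t :: real assume "0 \<le> t"
  then have "a t \<in> space (restrict_space borel S)"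
    using measurable_space[OF a, of t] by (simp add: space_restrict_space)
  then show "return (restrict_space borel S) (a t) \<in> space (prob_algebra (restrict_space borel S))"
    by (simp add: space_prob_algebra prob_space_return)
next
  fix \<phi> :: "real \<Rightarrow> real" assume "continuous_on S \<phi> \<and> bounded (\<phi> ` S)"
  then have m: "\<phi> \<in> borel_measurable (restrict_space borel S)"
    by (intro borel_measurable_continuous_on_restrict) simp
  have "(\<integral>y. \<phi> y \<partial>return (restrict_space borel S) (a t)) = \<phi> (a t)" if "t \<in> space (restrict_space borel {0..})" for t
    by (rule integral_return[OF measurable_space[OF a that] m])
  then show "(\<lambda>t. \<integral>y. \<phi> y \<partial>return (restrict_space borel S) (a t)) \<in> borel_measurable (restrict_space borel {0..})"
    using measurable_compose[OF a m] by (subst measurable_cong) auto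
qed

lemma relaxed_control_space:
  assumes "relaxed_control S \<mu>" "0 \<le> t"
  shows "prob_space (\<mu> t)" "space (\<mu> t) = S" "sets (\<mu> t) = sets (restrict_space borel S)"
proof -
  have "\<mu> t \<in> space (prob_algebra (restrict_space borel S))"
    using assms by (simp add: relaxed_control_def)
  then show "prob_space (\<mu> t)" and s: "sets (\<mu> t) = sets (restrict_space borel S)"
    by (auto simp: space_prob_algebra)
  show "space (\<mu> t) = S"
    using sets_eq_imp_space_eq[OF s] by (simp add: space_restrict_space)
qed

section \<open>Data of the production problem\<close>

locale production_problem =
  fixes A Q :: "real set" and R C :: "real \<Rightarrow> real" and \<beta> :: real
  assumes A_zero: "0 \<in> A"
    and Q_compact: "compact Q"
    and R_cont: "continuous_on Q R" and R_nonneg: "\<And>y. y \<in> Q \<Longrightarrow> 0 \<le> R y"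
    and C_cont: "continuous_on A C" and C_nonneg: "\<And>y. y \<in> A \<Longrightarrow> 0 \<le> C y"
    and \<beta>_pos: "0 < \<beta>"
begin

definition conv_C :: "real \<Rightarrow> real" where "conv_C = envelope A C"

definition conc_R :: "real \<Rightarrow> real" where "conc_R y = - envelope Q (\<lambda>y. - R y) y"

lemma bdd_C: "bdd_below (C ` A)"
  using C_nonneg by (auto simp: bdd_below_def)

lemma R_bound: obtains M where "\<And>y. y \<in> Q \<Longrightarrow> R y \<le> M"
  using compact_imp_bounded[OF compact_continuous_image[OF R_cont Q_compact]]
  unfolding bounded_iff by (metis abs_le_D1 imageI real_norm_def)

lemma bdd_R: "bdd_below ((\<lambda>y. - R y) ` Q)"
proof -
  obtain M where "\<And>y. y \<in> Q \<Longrightarrow> R y \<le> M" using R_bound by blast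
  then show ?thesis unfolding bdd_below_def by (intro exI[of _ "- M"]) auto
qed

lemma conv_C_nonneg: "y \<in> co_set A \<Longrightarrow> 0 \<le> conv_C y"
  using affine_le_envelope[of A 0 0 C y] C_nonneg by (simp add: conv_C_def)

lemma conv_C_le_C: "y \<in> A \<Longrightarrow> conv_C y \<le> C y"
  unfolding conv_C_def by (rule envelope_le[OF bdd_C])

lemma conc_R_nonneg:
  assumes y: "y \<in> co_set Q"
  shows "0 \<le> conc_R y"
proof -
  obtain v where v: "v \<in> chord_values Q (\<lambda>y. - R y) y" using chord_values_nonempty[OF y] by blast
  then obtain \<delta> a b where d: "v = \<delta> * - R a + (1 - \<delta>) * - R b" "0 \<le> \<delta>" "\<delta> \<le> 1" "a \<in> Q" "b \<in> Q"
    unfolding chord_values_def by auto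
  then have "0 \<le> \<delta> * R a" "0 \<le> (1 - \<delta>) * R b" using R_nonneg by auto
  then have "v \<le> 0" using d(1) by simp
  then show ?thesis using envelope_le_chord[OF bdd_R v] by (simp add: conc_R_def)
qed

lemma R_le_conc_R: "y \<in> Q \<Longrightarrow> R y \<le> conc_R y"
  using envelope_le[OF bdd_R, of y] by (simp add: conc_R_def)

lemma conc_R_bound: obtains M where "\<And>y. y \<in> co_set Q \<Longrightarrow> conc_R y \<le> M"
proof -
  obtain M where M: "\<And>y. y \<in> Q \<Longrightarrow> R y \<le> M" using R_bound by blast
  have "conc_R y \<le> M" if "y \<in> co_set Q" for y
    using affine_le_envelope[of Q "- M" 0 "\<lambda>y. - R y" y] M that by (simp add: conc_R_def)
  then show ?thesis by (rule that)
qed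

lemma co_set_Q_bound: obtains B where "\<And>y. y \<in> co_set Q \<Longrightarrow> \<bar>y\<bar> \<le> B"
proof -
  obtain B where B: "\<And>y. y \<in> Q \<Longrightarrow> \<bar>y\<bar> \<le> B"
    using compact_imp_bounded[OF Q_compact] by (auto simp: bounded_iff)
  have "\<bar>y\<bar> \<le> B" if y: "y \<in> co_set Q" for y
  proof -
    obtain a b where "a \<in> Q" "b \<in> Q" "a \<le> y" "y \<le> b" using y unfolding co_set_iff by blast
    then show ?thesis using B[of a] B[of b] by linarith
  qed
  then show ?thesis by (rule that)
qed

lemma R_measurable: "R \<in> borel_measurable (restrict_space borel Q)"
  by (rule borel_measurable_continuous_on_restrict[OF R_cont])

lemma C_measurable: "C \<in> borel_measurable (restrict_space borel A)"
  by (rule borel_measurable_continuous_on_restrict[OF C_cont])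

lemma conv_C_measurable: "conv_C \<in> borel_measurable (restrict_space borel (co_set A))"
  unfolding conv_C_def by (rule envelope_borel_measurable[OF bdd_C])

lemma conc_R_measurable: "conc_R \<in> borel_measurable (restrict_space borel (co_set Q))"
  unfolding conc_R_def[abs_def] by (intro borel_measurable_uminus envelope_borel_measurable[OF bdd_R])

lemma C_tilde_eq: "y \<in> co_set A \<Longrightarrow> C_tilde A C y = ereal (conv_C y)"
  unfolding conv_C_def by (rule C_tilde_eq_envelope[OF bdd_C])

lemma R_tilde_eq: "y \<in> co_set Q \<Longrightarrow> R_tilde Q R y = ereal (conc_R y)"
  unfolding conc_R_def by (rule R_tilde_eq_envelope[OF bdd_R])

abbreviation discounted :: "(real \<Rightarrow> real) \<Rightarrow> ennreal" where
  "discounted u \<equiv> \<integral>\<^sup>+t\<in>{0..}. ennreal (exp (- \<beta> * t) * u t) \<partial>lborel"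

lemma discounted_bounded_finite:
  assumes "\<And>t. 0 \<le> t \<Longrightarrow> u t \<le> M"
  shows "discounted u < \<infinity>"
proof -
  \<comment> \<open>The absolute value covers a negative bound \<open>M\<close>.\<close>
  have "discounted u \<le> discounted (\<lambda>t. 0 + \<bar>M\<bar>)"
    using assms
    by (intro nn_integral_mono)
      (fastforce split: split_indicator intro!: ennreal_leI mult_left_mono intro: order_trans[OF _ abs_ge_self])
  also have "\<dots> = discounted (\<lambda>t. 0) + ennreal (\<bar>M\<bar> / \<beta>)"
    by (rule nn_integral_discounted_add_const) (use \<beta>_pos in auto)
  also have "\<dots> < \<infinity>" by simp
  finally show ?thesis .
qed

lemma ext_integral_objective:
  assumes u: "u \<in> borel_measurable (restrict_space borel {0..})" "\<And>t. 0 \<le> t \<Longrightarrow> 0 \<le> u t"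
    "\<And>t. 0 \<le> t \<Longrightarrow> u t \<le> M"
    and w: "w \<in> borel_measurable (restrict_space borel {0..})" "\<And>t. 0 \<le> t \<Longrightarrow> 0 \<le> w t"
    and g: "\<And>t. 0 \<le> t \<Longrightarrow> g t = ereal (exp (- \<beta> * t) * (u t - w t))"
  shows "ext_integral g = enn2ereal (discounted u) - enn2ereal (discounted w)"
  by (rule ext_integral_diff[OF measurable_discounted[OF u(1)] _ measurable_discounted[OF w(1)]])
    (use u w g discounted_bounded_finite[of u M] in \<open>auto simp: algebra_simps\<close>)

lemma admissible_controls:
  assumes "(\<alpha>, q) \<in> admissible A' Q' x"
  shows "\<alpha> \<in> restrict_space borel {0..} \<rightarrow>\<^sub>M restrict_space borel A'"
    "q \<in> restrict_space borel {0..} \<rightarrow>\<^sub>M restrict_space borel Q'"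
    "\<And>t. 0 \<le> t \<Longrightarrow> \<alpha> t \<in> A'" "\<And>t. 0 \<le> t \<Longrightarrow> q t \<in> Q'"
    "locally_integrable \<alpha>" "\<And>t. 0 \<le> t \<Longrightarrow> 0 \<le> x + (LBINT s:{0..t}. \<alpha> s - q s)"
  using assms by (auto simp: admissible_def measurable_restrict_space2_iff space_restrict_space)

lemma objective_orig:
  assumes adm: "(\<alpha>, q) \<in> admissible A Q x"
  shows "ext_integral (\<lambda>t. ereal (exp (- \<beta> * t) * (R (q t) - C (\<alpha> t))))
    = enn2ereal (discounted (\<lambda>t. R (q t))) - enn2ereal (discounted (\<lambda>t. C (\<alpha> t)))"
proof -
  note ctl = admissible_controls[OF adm]
  obtain M where "\<And>y. y \<in> Q \<Longrightarrow> R y \<le> M" using R_bound by blast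
  then show ?thesis
    by (intro ext_integral_objective measurable_compose[OF ctl(1) C_measurable]
        measurable_compose[OF ctl(2) R_measurable])
      (auto intro: ctl R_nonneg C_nonneg)
qed

lemma objective_conv:
  assumes adm: "(\<alpha>, q) \<in> admissible (co_set A) (co_set Q) x"
  shows "ext_integral (\<lambda>t. ereal (exp (- \<beta> * t)) * (R_tilde Q R (q t) - C_tilde A C (\<alpha> t)))
    = enn2ereal (discounted (\<lambda>t. conc_R (q t))) - enn2ereal (discounted (\<lambda>t. conv_C (\<alpha> t)))"
proof -
  note ctl = admissible_controls[OF adm]
  obtain M where "\<And>y. y \<in> co_set Q \<Longrightarrow> conc_R y \<le> M" using conc_R_bound by blast
  then show ?thesis
    by (intro ext_integral_objective measurable_compose[OF ctl(1) conv_C_measurable]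
        measurable_compose[OF ctl(2) conc_R_measurable])
      (auto intro: ctl conc_R_nonneg conv_C_nonneg simp: ctl R_tilde_eq C_tilde_eq)
qed

section \<open>Comparison of the three value functions\<close>

lemma locally_integrable_Q:
  assumes "q \<in> restrict_space borel {0..} \<rightarrow>\<^sub>M restrict_space borel (co_set Q)"
  shows "locally_integrable q"
proof -
  obtain B where B: "\<And>y. y \<in> co_set Q \<Longrightarrow> \<bar>y\<bar> \<le> B" using co_set_Q_bound by blast
  have "q \<in> borel_measurable (restrict_space borel {0..})" "\<And>t. 0 \<le> t \<Longrightarrow> q t \<in> co_set Q"
    using assms by (auto simp: measurable_restrict_space2_iff space_restrict_space)
  then show ?thesis by (intro locally_integrable_bounded[of _ B] B)
qed

text \<open>
  A Dirac measure reproduces the value of the control, the revenue and the cost.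
\<close>
lemma value_orig_le_relaxed: "value_orig A Q R C \<beta> x \<le> value_relaxed A Q R C \<beta> x"
  unfolding value_orig_def
proof (rule SUP_least, clarify)
  fix \<alpha> q assume adm: "(\<alpha>, q) \<in> admissible A Q x"
  note ctl = admissible_controls[OF adm]
  let ?\<alpha> = "\<lambda>t. return (restrict_space borel A) (\<alpha> t)" and ?q = "\<lambda>t. return (restrict_space borel Q) (q t)"
  have mean: "(\<integral>y. y \<partial>return (restrict_space borel S) z) = z" if "z \<in> S" for S and z :: real
    by (rule integral_return) (use that in \<open>auto simp: space_restrict_space intro: measurable_restrict_space1\<close>)
  have mean_set: "(LBINT s:{0..t}. (\<integral>y. y \<partial>?\<alpha> s)) = (LBINT s:{0..t}. \<alpha> s)"
    "(LBINT s:{0..t}. (\<integral>y. y \<partial>?q s)) = (LBINT s:{0..t}. q s)" for t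
    by (intro set_lebesgue_integral_cong; simp add: mean ctl)+
  have mean_int: "set_integrable lborel {0..T} (\<lambda>t. \<integral>y. y \<partial>?\<alpha> t) \<longleftrightarrow> set_integrable lborel {0..T} \<alpha>" for T
    by (intro set_integrable_cong) (simp_all add: mean ctl)
  have "q \<in> restrict_space borel {0..} \<rightarrow>\<^sub>M restrict_space borel (co_set Q)"
    using ctl(2) subset_co_set[of Q] by (auto simp: measurable_restrict_space2_iff)
  then have lq: "locally_integrable q" by (rule locally_integrable_Q)
  have "(?\<alpha>, ?q) \<in> relaxed_admissible A Q x"
    unfolding relaxed_admissible_def
  proof (clarify, intro conjI allI impI)
    show "relaxed_control A ?\<alpha>" "relaxed_control Q ?q" by (intro relaxed_control_dirac ctl)+
    show "AE t in lborel. 0 \<le> t \<longrightarrow> integrable (?\<alpha> t) (\<lambda>y. y)"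
      by (intro AE_I2 impI integrable_dirac ctl)
    show "locally_integrable (\<lambda>t. \<integral>y. y \<partial>?\<alpha> t)"
      using ctl(5) by (simp only: locally_integrable_def mean_int)
    fix t :: real assume t: "0 \<le> t"
    show "0 \<le> x + (LBINT s:{0..t}. (\<integral>y. y \<partial>?\<alpha> s)) - (LBINT s:{0..t}. (\<integral>y. y \<partial>?q s))"
      using ctl(6)[OF t] state_split[OF ctl(5) lq t] by (simp only: mean_set)
  qed
  then have "enn2ereal (\<integral>\<^sup>+ t\<in>{0..}. (ennreal (exp (- \<beta> * t)) * (\<integral>\<^sup>+ y. ennreal (R y) \<partial>?q t)) \<partial>lborel)
        - enn2ereal (\<integral>\<^sup>+ t\<in>{0..}. (ennreal (exp (- \<beta> * t)) * (\<integral>\<^sup>+ y. ennreal (C y) \<partial>?\<alpha> t)) \<partial>lborel)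
      \<le> value_relaxed A Q R C \<beta> x"
    unfolding value_relaxed_def by (rule SUP_upper2) simp
  moreover have "(\<integral>\<^sup>+ t\<in>{0..}. (ennreal (exp (- \<beta> * t)) * (\<integral>\<^sup>+ y. ennreal (R y) \<partial>?q t)) \<partial>lborel) = discounted (\<lambda>t. R (q t))"
  proof (rule nn_integral_cong)
    fix t
    have "(\<integral>\<^sup>+ y. ennreal (R y) \<partial>?q t) = ennreal (R (q t))" if "0 \<le> t"
      using ctl(4)[OF that] R_measurable by (intro nn_integral_return) (auto simp: space_restrict_space)
    then show "ennreal (exp (- \<beta> * t)) * (\<integral>\<^sup>+ y. ennreal (R y) \<partial>?q t) * indicator {0..} t
        = ennreal (exp (- \<beta> * t) * R (q t)) * indicator {0..} t"
      using ctl(4) R_nonneg by (simp add: ennreal_mult split: split_indicator)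
  qed
  moreover have "(\<integral>\<^sup>+ t\<in>{0..}. (ennreal (exp (- \<beta> * t)) * (\<integral>\<^sup>+ y. ennreal (C y) \<partial>?\<alpha> t)) \<partial>lborel) = discounted (\<lambda>t. C (\<alpha> t))"
  proof (rule nn_integral_cong)
    fix t
    have "(\<integral>\<^sup>+ y. ennreal (C y) \<partial>?\<alpha> t) = ennreal (C (\<alpha> t))" if "0 \<le> t"
      using ctl(3)[OF that] C_measurable by (intro nn_integral_return) (auto simp: space_restrict_space)
    then show "ennreal (exp (- \<beta> * t)) * (\<integral>\<^sup>+ y. ennreal (C y) \<partial>?\<alpha> t) * indicator {0..} t
        = ennreal (exp (- \<beta> * t) * C (\<alpha> t)) * indicator {0..} t"
      using ctl(3) C_nonneg by (simp add: ennreal_mult split: split_indicator)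
  qed
  ultimately show "ext_integral (\<lambda>t. ereal (exp (- \<beta> * t) * (R (q t) - C (\<alpha> t)))) \<le> value_relaxed A Q R C \<beta> x"
    unfolding objective_orig[OF adm] by simp
qed

text \<open>
  Jensen's inequality for a production measure. The cost may have infinite integral, in which case there
  is nothing to prove.
\<close>
lemma nn_integral_ge_envelope:
  assumes M: "prob_space M" and sp: "space M = A" and meas: "C \<in> borel_measurable M"
    and int: "integrable M (\<lambda>y. y)"
  shows "(\<integral>y. y \<partial>M) \<in> co_set A" "ennreal (conv_C (\<integral>y. y \<partial>M)) \<le> (\<integral>\<^sup>+y. ennreal (C y) \<partial>M)"
proof -
  interpret prob_space M by fact
  have A: "y \<in> co_set A" if "y \<in> space M" for y using that sp subset_co_set by blast
  show "(\<integral>y. y \<partial>M) \<in> co_set A"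
    using mean_in_interval[OF finite_measure_axioms _ int A is_interval_co_set] prob_space by simp
  show "ennreal (conv_C (\<integral>y. y \<partial>M)) \<le> (\<integral>\<^sup>+y. ennreal (C y) \<partial>M)"
  proof (cases "(\<integral>\<^sup>+y. ennreal (C y) \<partial>M) = \<infinity>")
    case False
    have Cn: "AE y in M. 0 \<le> C y" using sp C_nonneg by (intro AE_I2) simp
    have Ci: "integrable M C"
      by (rule integrableI_nonneg[OF meas Cn]) (use False in \<open>simp add: top.not_eq_extremum\<close>)
    have le: "envelope A C y \<le> C y" if "y \<in> space M" for y
      using that sp conv_C_le_C by (simp add: conv_C_def)
    have "conv_C (\<integral>y. y \<partial>M) \<le> (\<integral>y. C y \<partial>M)"
      using envelope_Jensen[OF finite_measure_axioms _ int A bdd_C Ci le] prob_space by (simp add: conv_C_def)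
    then show ?thesis using nn_integral_eq_integral[OF Ci Cn] by (simp add: ennreal_leI)
  qed simp
qed

lemma nn_integral_le_envelope:
  assumes M: "prob_space M" and sp: "space M = Q" and meas: "R \<in> borel_measurable M"
    and id: "(\<lambda>y. y) \<in> borel_measurable M"
  shows "(\<integral>y. y \<partial>M) \<in> co_set Q" "(\<integral>\<^sup>+y. ennreal (R y) \<partial>M) \<le> ennreal (conc_R (\<integral>y. y \<partial>M))"
proof -
  interpret prob_space M by fact
  have Q: "y \<in> co_set Q" if "y \<in> space M" for y using that sp subset_co_set by blast
  obtain B where B: "\<And>y. y \<in> co_set Q \<Longrightarrow> \<bar>y\<bar> \<le> B" using co_set_Q_bound by blast
  have int: "integrable M (\<lambda>y. y)"
    by (rule integrable_const_bound[OF AE_I2 id, where B = B]) (use B Q in simp)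
  show "(\<integral>y. y \<partial>M) \<in> co_set Q"
    using mean_in_interval[OF finite_measure_axioms _ int Q is_interval_co_set] prob_space by simp
  obtain K where K: "\<And>y. y \<in> Q \<Longrightarrow> R y \<le> K" using R_bound by blast
  have Rn: "AE y in M. 0 \<le> R y" using sp R_nonneg by (intro AE_I2) simp
  have Ri: "integrable M R"
    by (rule integrable_const_bound[OF AE_I2 meas, where B = K]) (use K sp R_nonneg in simp)
  have Ri': "integrable M (\<lambda>y. - R y)" using Ri by simp
  have le: "envelope Q (\<lambda>y. - R y) y \<le> - R y" if "y \<in> space M" for y
    using that sp R_le_conc_R[of y] by (simp add: conc_R_def)
  have "- conc_R (\<integral>y. y \<partial>M) \<le> (\<integral>y. - R y \<partial>M)"
    using envelope_Jensen[OF finite_measure_axioms _ int Q bdd_R Ri' le] prob_space by (simp add: conc_R_def)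
  then show "(\<integral>\<^sup>+y. ennreal (R y) \<partial>M) \<le> ennreal (conc_R (\<integral>y. y \<partial>M))"
    using nn_integral_eq_integral[OF Ri Rn] by (simp add: ennreal_leI)
qed

text \<open>
  The barycentres of relaxed controls are convexified controls that generate the same state.
\<close>
lemma value_relaxed_le_conv: "value_relaxed A Q R C \<beta> x \<le> value_conv A Q R C \<beta> x"
  unfolding value_relaxed_def
proof (rule SUP_least, clarify)
  fix \<alpha> q assume "(\<alpha>, q) \<in> relaxed_admissible A Q x"
  then have \<alpha>: "relaxed_control A \<alpha>" and q: "relaxed_control Q q"
    and int: "AE t in lborel. 0 \<le> t \<longrightarrow> integrable (\<alpha> t) (\<lambda>y. y)"
    and loc: "locally_integrable (\<lambda>t. \<integral>y. y \<partial>\<alpha> t)"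
    and X: "\<And>t. 0 \<le> t \<Longrightarrow> 0 \<le> x + (LBINT s:{0..t}. (\<integral>y. y \<partial>\<alpha> s)) - (LBINT s:{0..t}. (\<integral>y. y \<partial>q s))"
    by (auto simp: relaxed_admissible_def)
  define a where "a t = (\<integral>y. y \<partial>\<alpha> t)" for t
  define b where "b t = (\<integral>y. y \<partial>q t)" for t
  have measA: "C \<in> borel_measurable (\<alpha> t)" if "0 \<le> t" for t
    using C_measurable relaxed_control_space(3)[OF \<alpha> that] measurable_cong_sets by blast
  have idQ: "(\<lambda>y. y) \<in> borel_measurable (q t)" "R \<in> borel_measurable (q t)" if "0 \<le> t" for t
  proof -
    have "(\<lambda>y. y) \<in> borel_measurable (restrict_space borel Q)"
      by (intro measurable_restrict_space1) simp
    then show "(\<lambda>y. y) \<in> borel_measurable (q t)" "R \<in> borel_measurable (q t)"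
      using R_measurable relaxed_control_space(3)[OF q that] measurable_cong_sets by blast+
  qed
  have b: "b t \<in> co_set Q" "(\<integral>\<^sup>+y. ennreal (R y) \<partial>q t) \<le> ennreal (conc_R (b t))" if "0 \<le> t" for t
    unfolding b_def
    by (rule nn_integral_le_envelope; intro relaxed_control_space[OF q that] idQ that)+
  have a: "a t \<in> co_set A" "integrable (\<alpha> t) (\<lambda>y. y) \<Longrightarrow> ennreal (conv_C (a t)) \<le> (\<integral>\<^sup>+y. ennreal (C y) \<partial>\<alpha> t)"
    if t: "0 \<le> t" for t
  proof -
    note ge = nn_integral_ge_envelope[OF relaxed_control_space(1,2)[OF \<alpha> t] measA[OF t]]
    show "integrable (\<alpha> t) (\<lambda>y. y) \<Longrightarrow> ennreal (conv_C (a t)) \<le> (\<integral>\<^sup>+y. ennreal (C y) \<partial>\<alpha> t)"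
      unfolding a_def by (rule ge(2))
    show "a t \<in> co_set A"
    proof (cases "integrable (\<alpha> t) (\<lambda>y. y)")
      case True then show ?thesis unfolding a_def by (rule ge(1))
    next
      case False
      \<comment> \<open>A measure with infinite mean has Bochner mean \<open>0\<close>, which is again a point of \<open>A\<close>.\<close>
      then show ?thesis using A_zero subset_co_set by (auto simp: a_def not_integrable_integral_eq)
    qed
  qed
  have "continuous_on Q (\<lambda>y. y) \<and> bounded ((\<lambda>y. y) ` Q)"
    using compact_imp_bounded[OF Q_compact] by simp
  then have "b \<in> borel_measurable (restrict_space borel {0..})"
    using q unfolding relaxed_control_def b_def[abs_def] by blast
  then have bm: "b \<in> restrict_space borel {0..} \<rightarrow>\<^sub>M restrict_space borel (co_set Q)"
    using b(1) by (auto simp: measurable_restrict_space2_iff space_restrict_space)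
  have la: "locally_integrable a" using loc by (simp add: a_def[abs_def])
  then have am: "a \<in> restrict_space borel {0..} \<rightarrow>\<^sub>M restrict_space borel (co_set A)"
    using a(1) borel_measurable_of_locally_integrable
    by (auto simp: measurable_restrict_space2_iff space_restrict_space)
  have adm: "(a, b) \<in> admissible (co_set A) (co_set Q) x"
    unfolding admissible_def
  proof (clarify, intro conjI am bm la allI impI)
    fix t :: real assume t: "0 \<le> t"
    show "0 \<le> x + (LBINT s:{0..t}. a s - b s)"
      using X[OF t] state_split[OF la locally_integrable_Q[OF bm] t]
      by (simp add: a_def b_def)
  qed
  have P: "(\<integral>\<^sup>+ t\<in>{0..}. (ennreal (exp (- \<beta> * t)) * (\<integral>\<^sup>+ y. ennreal (R y) \<partial>q t)) \<partial>lborel) \<le> discounted (\<lambda>t. conc_R (b t))"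
  proof (rule nn_integral_mono)
    fix t
    show "ennreal (exp (- \<beta> * t)) * (\<integral>\<^sup>+ y. ennreal (R y) \<partial>q t) * indicator {0..} t
        \<le> ennreal (exp (- \<beta> * t) * conc_R (b t)) * indicator {0..} t"
    proof (cases "0 \<le> t")
      case True
      then show ?thesis using b[OF True] conc_R_nonneg
        by (simp add: ennreal_mult mult_left_mono)
    qed simp
  qed
  have N: "discounted (\<lambda>t. conv_C (a t)) \<le> (\<integral>\<^sup>+ t\<in>{0..}. (ennreal (exp (- \<beta> * t)) * (\<integral>\<^sup>+ y. ennreal (C y) \<partial>\<alpha> t)) \<partial>lborel)"
  proof (rule nn_integral_mono_AE)
    show "AE t in lborel. ennreal (exp (- \<beta> * t) * conv_C (a t)) * indicator {0..} t
        \<le> ennreal (exp (- \<beta> * t)) * (\<integral>\<^sup>+ y. ennreal (C y) \<partial>\<alpha> t) * indicator {0..} t"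
      using int
    proof eventually_elim
      case (elim t)
      show ?case
      proof (cases "0 \<le> t")
        case True
        then show ?thesis using a[OF True] elim conv_C_nonneg
          by (simp add: ennreal_mult mult_left_mono)
      qed simp
    qed
  qed
  have "enn2ereal (\<integral>\<^sup>+ t\<in>{0..}. (ennreal (exp (- \<beta> * t)) * (\<integral>\<^sup>+ y. ennreal (R y) \<partial>q t)) \<partial>lborel)
        - enn2ereal (\<integral>\<^sup>+ t\<in>{0..}. (ennreal (exp (- \<beta> * t)) * (\<integral>\<^sup>+ y. ennreal (C y) \<partial>\<alpha> t)) \<partial>lborel)
      \<le> enn2ereal (discounted (\<lambda>t. conc_R (b t))) - enn2ereal (discounted (\<lambda>t. conv_C (a t)))"
    using P N by (intro ereal_minus_mono) (simp_all add: less_eq_ennreal.rep_eq)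
  also have "\<dots> \<le> value_conv A Q R C \<beta> x"
    unfolding value_conv_def using objective_conv[OF adm]
    by (intro SUP_upper2[OF adm]) simp
  finally show "enn2ereal (\<integral>\<^sup>+ t\<in>{0..}. (ennreal (exp (- \<beta> * t)) * (\<integral>\<^sup>+ y. ennreal (R y) \<partial>q t)) \<partial>lborel)
        - enn2ereal (\<integral>\<^sup>+ t\<in>{0..}. (ennreal (exp (- \<beta> * t)) * (\<integral>\<^sup>+ y. ennreal (C y) \<partial>\<alpha> t)) \<partial>lborel)
      \<le> value_conv A Q R C \<beta> x" .
qed

text \<open>
  The grid step also serves as tolerance for the chords, so that a single parameter tends to zero in the
  end. Production switches from the higher to the lower level and sales from the lower to the higher one,
  which makes the net rate nonincreasing on each cell.
\<close>
lemma chattering: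
  assumes h: "0 < h" and adm: "(\<alpha>, q) \<in> admissible (co_set A) (co_set Q) x"
    and fin: "discounted (\<lambda>t. conv_C (\<alpha> t)) < \<infinity>"
  obtains \<alpha>' q' where "(\<alpha>', q') \<in> admissible A Q x"
    "discounted (\<lambda>t. C (\<alpha>' t)) \<le> ennreal (exp (\<beta> * h)) * (discounted (\<lambda>t. conv_C (\<alpha> t)) + ennreal (h / \<beta>))"
    "discounted (\<lambda>t. conc_R (q t)) \<le> ennreal (exp (\<beta> * h)) * (discounted (\<lambda>t. R (q' t)) + ennreal (h / \<beta>))"
proof -
  note ctl = admissible_controls[OF adm]
  have lq: "locally_integrable q" by (rule locally_integrable_Q[OF ctl(2)])
  have cm: "(\<lambda>t. conv_C (\<alpha> t)) \<in> borel_measurable (restrict_space borel {0..})"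
    by (rule measurable_compose[OF ctl(1) conv_C_measurable])
  have rm: "(\<lambda>t. conc_R (q t)) \<in> borel_measurable (restrict_space borel {0..})"
    by (rule measurable_compose[OF ctl(2) conc_R_measurable])
  have cn: "0 \<le> conv_C (\<alpha> t)" if "0 \<le> t" for t using conv_C_nonneg ctl(3) that by blast
  have rn: "0 \<le> conc_R (q t)" if "0 \<le> t" for t using conc_R_nonneg ctl(4) that by blast
  have ci: "set_integrable lborel (cell h k) (\<lambda>t. conv_C (\<alpha> t))" for k
    by (rule set_integrable_cell_of_discounted[OF h \<beta>_pos cm cn fin])
  obtain K where K: "\<And>y. y \<in> co_set Q \<Longrightarrow> conc_R y \<le> K" using conc_R_bound by blast
  have ri: "set_integrable lborel (cell h k) (\<lambda>t. conc_R (q t))" for k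
    by (rule set_integrable_cell_of_discounted[OF h \<beta>_pos rm rn])
      (use discounted_bounded_finite[of "\<lambda>t. conc_R (q t)" K] K ctl(4) in auto)
  have ri': "set_integrable lborel (cell h k) (\<lambda>t. envelope Q (\<lambda>y. - R y) (q t))" for k
    using ri[of k] by (simp add: conc_R_def set_integrable_def)
  have cells: "set_integrable lborel (cell h k) \<alpha>" "set_integrable lborel (cell h k) q" for k
    using ctl(5) lq by (simp_all add: locally_integrable_iff_cells[OF h])
  obtain p a b where \<alpha>': "\<And>k. a k \<in> A" "\<And>k. b k \<in> A" "\<And>k. a k \<le> b k" "\<And>k. 0 \<le> p k" "\<And>k. p k \<le> (1::real)"
    "\<And>k. h * (p k * a k + (1 - p k) * b k) = (LBINT t:cell h k. \<alpha> t)"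
    "\<And>k. h * (p k * C (a k) + (1 - p k) * C (b k)) \<le> (LBINT t:cell h k. envelope A C (\<alpha> t)) + h * h"
    by (rule near_optimal_switching[OF h h bdd_C _ cells(1) ci[unfolded conv_C_def]], erule ctl(3))
      (rule that, assumption+)
  obtain p' a' b' where q': "\<And>k. a' k \<in> Q" "\<And>k. b' k \<in> Q" "\<And>k. a' k \<le> b' k" "\<And>k. 0 \<le> p' k" "\<And>k. p' k \<le> (1::real)"
    "\<And>k. h * (p' k * a' k + (1 - p' k) * b' k) = (LBINT t:cell h k. q t)"
    "\<And>k. h * (p' k * - R (a' k) + (1 - p' k) * - R (b' k))
       \<le> (LBINT t:cell h k. envelope Q (\<lambda>y. - R y) (q t)) + h * h"
    by (rule near_optimal_switching[OF h h bdd_R _ cells(2) ri'], erule ctl(4))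
      (rule that, assumption+)
  \<comment> \<open>The higher level \<open>b\<close> of production comes first, so the weights of its two levels are exchanged.\<close>
  let ?\<alpha> = "switching h (\<lambda>k. 1 - p k) b a" and ?q = "switching h p' a' b'"
  have p1: "0 \<le> 1 - p k" "1 - p k \<le> 1" for k using \<alpha>' by auto
  note int\<alpha> = switching_cell_integral[OF h, of "\<lambda>k. 1 - p k", OF p1, of _ _ b a]
  note intq = switching_cell_integral[OF h, of p', OF q'(4,5), of _ _ a' b']
  have in_A: "?\<alpha> t \<in> A" and in_Q: "?q t \<in> Q" for t by (intro switching_in \<alpha>' q')+
  have m\<alpha>: "?\<alpha> \<in> restrict_space borel {0..} \<rightarrow>\<^sub>M restrict_space borel A"
    and mq: "?q \<in> restrict_space borel {0..} \<rightarrow>\<^sub>M restrict_space borel Q"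
    using in_A in_Q
    by (auto simp: measurable_restrict_space2_iff intro!: measurable_restrict_space1 switching_borel_measurable)
  have loc: "locally_integrable ?\<alpha>" "locally_integrable ?q"
    using int\<alpha>(1)[of _ "\<lambda>y. y"] intq(1)[of _ "\<lambda>y. y"] by (simp_all add: locally_integrable_iff_cells[OF h])
  have "0 \<le> x + (LBINT s:{0..t}. ?\<alpha> s - ?q s)" if t: "0 \<le> t" for t
  proof (rule nonneg_of_nonneg_at_grid[OF h _ _ _ _ ctl(6) t])
    show "locally_integrable (\<lambda>s. ?\<alpha> s - ?q s)" "locally_integrable (\<lambda>s. \<alpha> s - q s)"
      by (intro locally_integrable_diff loc ctl(5) lq)+
    fix k
    have "(LBINT t:cell h k. ?\<alpha> t - ?q t) = (LBINT t:cell h k. ?\<alpha> t) - (LBINT t:cell h k. ?q t)"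
      by (rule set_integral_diff(2)[OF int\<alpha>(1)[of _ "\<lambda>y. y"] intq(1)[of _ "\<lambda>y. y"]])
    also have "(LBINT t:cell h k. ?\<alpha> t) = (LBINT t:cell h k. \<alpha> t)"
      using int\<alpha>(2)[of k "\<lambda>y. y"] \<alpha>'(6)[of k] by (simp add: algebra_simps)
    also have "(LBINT t:cell h k. ?q t) = (LBINT t:cell h k. q t)"
      using intq(2)[of k "\<lambda>y. y"] q'(6)[of k] by simp
    also have "(LBINT t:cell h k. \<alpha> t) - (LBINT t:cell h k. q t) = (LBINT t:cell h k. \<alpha> t - q t)"
      by (rule set_integral_diff(2)[symmetric, OF cells])
    finally show "(LBINT t:cell h k. ?\<alpha> t - ?q t) = (LBINT t:cell h k. \<alpha> t - q t)" .
  next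
    fix k s t assume st: "s \<in> cell h k" "t \<in> cell h k" "s \<le> t"
    have "?\<alpha> t \<le> ?\<alpha> s"
      using st \<alpha>'(3)[of k] by (simp add: switching_on_cell[OF h])
    moreover have "?q s \<le> ?q t"
      using st q'(3)[of k] by (simp add: switching_on_cell[OF h])
    ultimately show "?\<alpha> t - ?q t \<le> ?\<alpha> s - ?q s" by simp
  qed
  then have adm': "(?\<alpha>, ?q) \<in> admissible A Q x"
    using m\<alpha> mq loc(1) by (simp add: admissible_def)
  have Cm: "(\<lambda>t. C (?\<alpha> t)) \<in> borel_measurable (restrict_space borel {0..})"
    by (rule measurable_compose[OF m\<alpha> C_measurable])
  have Rm: "(\<lambda>t. R (?q t)) \<in> borel_measurable (restrict_space borel {0..})"
    by (rule measurable_compose[OF mq R_measurable])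
  \<comment> \<open>A constant is a trivial switching control, which gives its integral over a cell.\<close>
  have const: "set_integrable lborel (cell h k) (\<lambda>t. h)" "(LBINT t:cell h k. h) = h * h" for k
    using switching_cell_integral[OF h, of "\<lambda>k. 0" k "\<lambda>y. h" "\<lambda>k. 0" "\<lambda>k. 0"] by simp_all
  have "discounted (\<lambda>t. C (?\<alpha> t)) \<le> ennreal (exp (\<beta> * h)) * discounted (\<lambda>t. conv_C (\<alpha> t) + h)"
  proof (rule discounted_integral_le[OF h \<beta>_pos Cm])
    show "(\<lambda>t. conv_C (\<alpha> t) + h) \<in> borel_measurable (restrict_space borel {0..})" using cm by simp
    show "0 \<le> C (?\<alpha> t)" for t by (intro C_nonneg in_A)
    show "0 \<le> conv_C (\<alpha> t) + h" if "0 \<le> t" for t using cn[OF that] h by simp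
    fix k
    show "set_integrable lborel (cell h k) (\<lambda>t. C (?\<alpha> t))" by (rule int\<alpha>(1))
    show "set_integrable lborel (cell h k) (\<lambda>t. conv_C (\<alpha> t) + h)"
      by (rule set_integral_add(1)[OF ci const(1)])
    have "(LBINT t:cell h k. C (?\<alpha> t)) \<le> (LBINT t:cell h k. conv_C (\<alpha> t)) + h * h"
      using \<alpha>'(7)[of k] int\<alpha>(2)[of k C] by (simp add: conv_C_def algebra_simps)
    also have "\<dots> = (LBINT t:cell h k. conv_C (\<alpha> t) + h)"
      by (simp add: set_integral_add(2)[OF ci const(1)] const(2))
    finally show "(LBINT t:cell h k. C (?\<alpha> t)) \<le> (LBINT t:cell h k. conv_C (\<alpha> t) + h)" .
  qed
  also have "discounted (\<lambda>t. conv_C (\<alpha> t) + h) = discounted (\<lambda>t. conv_C (\<alpha> t)) + ennreal (h / \<beta>)"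
    by (rule nn_integral_discounted_add_const[OF \<beta>_pos less_imp_le[OF h] cm cn])
  finally have cost: "discounted (\<lambda>t. C (?\<alpha> t)) \<le> ennreal (exp (\<beta> * h)) * (discounted (\<lambda>t. conv_C (\<alpha> t)) + ennreal (h / \<beta>))" .
  have "discounted (\<lambda>t. conc_R (q t)) \<le> ennreal (exp (\<beta> * h)) * discounted (\<lambda>t. R (?q t) + h)"
  proof (rule discounted_integral_le[OF h \<beta>_pos rm rn ri])
    show "(\<lambda>t. R (?q t) + h) \<in> borel_measurable (restrict_space borel {0..})" using Rm by simp
    show "0 \<le> R (?q t) + h" for t using R_nonneg[OF in_Q[of t]] h by simp
    fix k
    show "set_integrable lborel (cell h k) (\<lambda>t. R (?q t) + h)"
      by (rule set_integral_add(1)[OF intq(1) const(1)])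
    have "(LBINT t:cell h k. conc_R (q t)) = - (LBINT t:cell h k. envelope Q (\<lambda>y. - R y) (q t))"
      by (simp add: conc_R_def set_lebesgue_integral_def)
    also have "\<dots> \<le> (LBINT t:cell h k. R (?q t)) + h * h"
      using q'(7)[of k] intq(2)[of k R] by (simp add: algebra_simps)
    also have "\<dots> = (LBINT t:cell h k. R (?q t) + h)"
      by (simp add: set_integral_add(2)[OF intq(1) const(1)] const(2))
    finally show "(LBINT t:cell h k. conc_R (q t)) \<le> (LBINT t:cell h k. R (?q t) + h)" .
  qed
  also have "discounted (\<lambda>t. R (?q t) + h) = discounted (\<lambda>t. R (?q t)) + ennreal (h / \<beta>)"
    by (rule nn_integral_discounted_add_const[OF \<beta>_pos less_imp_le[OF h] Rm]) (intro R_nonneg in_Q)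
  finally show ?thesis using that[OF adm' cost] by blast
qed

text \<open>
  Let the grid step tend to zero in the chattering construction.
\<close>
lemma value_conv_le_orig: "value_conv A Q R C \<beta> x \<le> value_orig A Q R C \<beta> x"
  unfolding value_conv_def
proof (rule SUP_least, clarify)
  fix \<alpha> q assume adm: "(\<alpha>, q) \<in> admissible (co_set A) (co_set Q) x"
  let ?v = "value_orig A Q R C \<beta> x"
  let ?P = "discounted (\<lambda>t. conc_R (q t))" and ?N = "discounted (\<lambda>t. conv_C (\<alpha> t))"
  obtain K where "\<And>y. y \<in> co_set Q \<Longrightarrow> conc_R y \<le> K" using conc_R_bound by blast
  then have "?P < \<infinity>" using admissible_controls(4)[OF adm] by (intro discounted_bounded_finite[of _ K]) simp
  then obtain P where P: "0 \<le> P" "?P = ennreal P" by (cases ?P rule: ennreal_cases) auto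
  show "ext_integral (\<lambda>t. ereal (exp (- \<beta> * t)) * (R_tilde Q R (q t) - C_tilde A C (\<alpha> t))) \<le> ?v"
    unfolding objective_conv[OF adm]
  proof (cases "?N = \<infinity>")
    case True
    then show "enn2ereal ?P - enn2ereal ?N \<le> ?v" using P by simp
  next
    case False
    then obtain N where N: "0 \<le> N" "?N = ennreal N" by (cases ?N rule: ennreal_cases) auto
    have approx: "ereal (exp (- \<beta> * h) * P - h / \<beta> - exp (\<beta> * h) * (N + h / \<beta>)) \<le> ?v" if h: "0 < h" for h
    proof -
      have "?N < \<infinity>" using N by simp
      from chattering[OF h adm this] obtain \<alpha>' q' where adm': "(\<alpha>', q') \<in> admissible A Q x"
        and cost: "discounted (\<lambda>t. C (\<alpha>' t)) \<le> ennreal (exp (\<beta> * h)) * (?N + ennreal (h / \<beta>))"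
        and rev: "?P \<le> ennreal (exp (\<beta> * h)) * (discounted (\<lambda>t. R (q' t)) + ennreal (h / \<beta>))"
        by blast
      have h\<beta>: "0 \<le> h / \<beta>" using h \<beta>_pos by simp
      obtain M where "\<And>y. y \<in> Q \<Longrightarrow> R y \<le> M" using R_bound by blast
      then have "discounted (\<lambda>t. R (q' t)) < \<infinity>" using admissible_controls(4)[OF adm'] by (intro discounted_bounded_finite[of _ M]) simp
      then obtain P' where P': "0 \<le> P'" "discounted (\<lambda>t. R (q' t)) = ennreal P'"
        by (cases "discounted (\<lambda>t. R (q' t))" rule: ennreal_cases) auto
      have cost': "discounted (\<lambda>t. C (\<alpha>' t)) \<le> ennreal (exp (\<beta> * h) * (N + h / \<beta>))"
        using cost N h\<beta> by (simp add: ennreal_mult)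
      have "ennreal P \<le> ennreal (exp (\<beta> * h) * (P' + h / \<beta>))"
        using rev P P' h\<beta> by (simp add: ennreal_mult)
      then have "P \<le> exp (\<beta> * h) * (P' + h / \<beta>)"
        using P' h\<beta> by (subst (asm) ennreal_le_iff) auto
      then have "exp (- \<beta> * h) * P \<le> exp (- \<beta> * h) * (exp (\<beta> * h) * (P' + h / \<beta>))"
        by (intro mult_left_mono) auto
      also have "\<dots> = (exp (- \<beta> * h) * exp (\<beta> * h)) * (P' + h / \<beta>)" by (simp only: mult.assoc)
      also have "exp (- \<beta> * h) * exp (\<beta> * h) = 1" by (simp add: exp_add[symmetric])
      finally have rev': "exp (- \<beta> * h) * P - h / \<beta> \<le> P'" by simp
      have "ereal (exp (- \<beta> * h) * P - h / \<beta> - exp (\<beta> * h) * (N + h / \<beta>))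
          = ereal (exp (- \<beta> * h) * P - h / \<beta>) - ereal (exp (\<beta> * h) * (N + h / \<beta>))" by simp
      also have "\<dots> \<le> enn2ereal (discounted (\<lambda>t. R (q' t))) - enn2ereal (discounted (\<lambda>t. C (\<alpha>' t)))"
      proof (rule ereal_minus_mono)
        show "ereal (exp (- \<beta> * h) * P - h / \<beta>) \<le> enn2ereal (discounted (\<lambda>t. R (q' t)))"
          using rev' P' by simp
        show "enn2ereal (discounted (\<lambda>t. C (\<alpha>' t))) \<le> ereal (exp (\<beta> * h) * (N + h / \<beta>))"
          using cost' N h\<beta> by (simp add: less_eq_ennreal.rep_eq)
      qed
      also have "\<dots> = ext_integral (\<lambda>t. ereal (exp (- \<beta> * t) * (R (q' t) - C (\<alpha>' t))))"
        by (rule objective_orig[OF adm', symmetric])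
      also have "\<dots> \<le> ?v" unfolding value_orig_def by (rule SUP_upper2[OF adm']) simp
      finally show ?thesis .
    qed
    have "((\<lambda>h. exp (- \<beta> * h) * P - h / \<beta> - exp (\<beta> * h) * (N + h / \<beta>))
        \<longlongrightarrow> exp (- \<beta> * 0) * P - 0 / \<beta> - exp (\<beta> * 0) * (N + 0 / \<beta>)) (at_right 0)"
      by (intro tendsto_intros) (use \<beta>_pos in auto)
    then have "((\<lambda>h. exp (- \<beta> * h) * P - h / \<beta> - exp (\<beta> * h) * (N + h / \<beta>)) \<longlongrightarrow> P - N) (at_right 0)"
      by simp
    then have lim: "((\<lambda>h. ereal (exp (- \<beta> * h) * P - h / \<beta> - exp (\<beta> * h) * (N + h / \<beta>))) \<longlongrightarrow> ereal (P - N)) (at_right 0)"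
      by (rule tendsto_ereal)
    have "ereal (P - N) \<le> ?v"
    proof (rule tendsto_upperbound[OF lim])
      show "\<forall>\<^sub>F h in at_right 0. ereal (exp (- \<beta> * h) * P - h / \<beta> - exp (\<beta> * h) * (N + h / \<beta>)) \<le> ?v"
        using approx by (auto simp: eventually_at_right_field intro: exI[of _ 1])
    qed simp
    then show "enn2ereal ?P - enn2ereal ?N \<le> ?v" using P N by simp
  qed
qed

end

theorem theorem2:
  fixes A Q :: "real set" and R C :: "real \<Rightarrow> real" and \<beta> :: real
  assumes "A \<subseteq> {0..}" and "closed A" and "0 \<in> A" and "A - {0} \<noteq> {}"
    and "Q \<subseteq> {0..}" and "compact Q" and "0 \<in> Q" and "Q - {0} \<noteq> {}"
    and "continuous_on Q R" and "\<forall>y\<in>Q. 0 \<le> R y" and "R 0 = 0"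
    and "continuous_on A C" and "\<forall>y\<in>A. 0 \<le> C y" and "mono_on A C"
    and "\<not> bounded A \<longrightarrow> filterlim (\<lambda>a. C a / a) at_top (inf at_top (principal A))"
    and "\<beta> > 0"
  shows "\<forall>x\<ge>0. value_orig A Q R C \<beta> x = value_relaxed A Q R C \<beta> x
              \<and> value_relaxed A Q R C \<beta> x = value_conv A Q R C \<beta> x"
proof -
  interpret production_problem A Q R C \<beta>
    by unfold_locales (use assms in auto)
  show ?thesis
    using value_orig_le_relaxed value_relaxed_le_conv value_conv_le_orig
    by (meson order.antisym order.trans)
qed

end
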